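(* Let $\Gamma$ be a commutative weakly distance-regular digraph which is not an undirected graph. Then the underlying graph of $\Gamma$ is a Doob graph $G(d_1,d_2)$ (for some $d_1>0$, $d_2\ge0$) if and only if $\Gamma$ is isomorphic to $\mathrm{Cay}(\mathbb{Z}_4\times\mathbb{Z}_4,\{(1,0),(0,1),(-1,-1)\})$.
   Context: A digraph $\Gamma$ has a finite vertex set and an arc set of ordered pairs of distinct vertices; it is an undirected graph if the arc set is symmetric. $\partial_\Gamma(x,y)$ is the directed distance, $\tilde\partial_\Gamma(x,y)=(\partial_\Gamma(x,y),\partial_\Gamma(y,x))$, $\tilde\partial(\Gamma)$ is the set of these pairs, and $P_{\tilde i,\tilde j}(x,y)=\{z:\tilde\partial_\Gamma(x,z)=\tilde i,\tilde\partial_\Gamma(z,y)=\tilde j\}$. A strongly connected $\Gamma$ is weakly distance-regular if $|P_{\tilde i,\tilde j}(x,y)|$ depends only on $\tilde i,\tilde j$ and $\tilde h=\tilde\partial_\Gamma(x,y)$ (this number is $p^{\tilde h}_{\tilde i,\tilde j}$), and commutative if $p^{\tilde h}_{\tilde i,\tilde j}=p^{\tilde h}_{\tilde j,\tilde i}$ always. The underlying graph has the same vertices, $x\sim y$ iff $(x,y)$ or $(y,x)$ is an arc. For an abelian group $G$ and $C\subseteq G$, $\mathrm{Cay}(G,C)$ has vertex set $G$ and arcs $(g,g+c)$, $c\in C$. The Shrikhande graph is $\mathrm{Cay}(\mathbb{Z}_4\times\mathbb{Z}_4,\{(\pm1,0),(0,\pm1),\pm(1,1)\})$. $H(d_2,4)$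 is the Hamming graph on $\mathbb{Z}_4^{d_2}$ (adjacent iff differing in exactly one coordinate). The Cartesian product of graphs has vertex set the product, $(u,v)\sim(u',v')$ iff ($u=u'$ and $v\sim v'$) or ($u\sim u'$ and $v=v'$). The Doob graph $G(d_1,d_2)$, $d_1>0$, $d_2\ge0$, is the Cartesian product of $H(d_2,4)$ with $d_1$ copies of the Shrikhande graph. *)

theory Defs
  imports
    "Graph_Theory.Pair_Digraph"
    "Graph_Theory.Digraph_Isomorphism"
    "HOL-Library.Numeral_Type"
    "HOL-Library.Product_Plus"
begin

text \<open>
  Digraphs are the pair digraphs of the Graph Theory entry: \<^locale>\<open>pair_digraph\<close>
  says that the vertex set is finite and the arcs are ordered pairs of distinct vertices.
  The underlying graph is \<^const>\<open>mk_symmetric\<close>.  The coercion \<^const>\<open>with_proj\<close>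
  is inserted automatically.
\<close>

text \<open>
  The length of a shortest directed walk.  The value is unspecified if there is none,
  which does not happen in a strongly connected digraph.
\<close>
definition directed_distance :: "'a pair_pre_digraph \<Rightarrow> 'a \<Rightarrow> 'a \<Rightarrow> nat" where
  "directed_distance G x y = (LEAST n. \<exists>p. pre_digraph.awalk G x p y \<and> length p = n)"

definition two_way_distance :: "'a pair_pre_digraph \<Rightarrow> 'a \<Rightarrow> 'a \<Rightarrow> nat \<times> nat" where
  "two_way_distance G x y = (directed_distance G x y, directed_distance G y x)"

definition two_way_distances :: "'a pair_pre_digraph \<Rightarrow> (nat \<times> nat) set" where
  "two_way_distances G = {two_way_distance G x y | x y. x \<in> pverts G \<and> y \<in> pverts G}"

definition P_set ::
    "'a pair_pre_digraph \<Rightarrow> nat \<times> nat \<Rightarrow> nat \<times> nat \<Rightarrow> 'a \<Rightarrow> 'a \<Rightarrow> 'a set" where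
  "P_set G i j x y =
     {z \<in> pverts G. two_way_distance G x z = i \<and> two_way_distance G z y = j}"

locale weakly_distance_regular_digraph = pair_digraph +
  assumes strongly_connected: "strongly_connected G"
    and weakly_distance_regular:
      "\<lbrakk>i \<in> two_way_distances G; j \<in> two_way_distances G;
        x \<in> pverts G; y \<in> pverts G; x' \<in> pverts G; y' \<in> pverts G;
        two_way_distance G x y = two_way_distance G x' y'\<rbrakk>
       \<Longrightarrow> card (P_set G i j x y) = card (P_set G i j x' y')"

text \<open>
  The number \<open>p\<^sup>h\<^sub>i\<^sub>j\<close>, which is well defined for \<open>h\<close>, \<open>i\<close>, \<open>j\<close> in
  \<^const>\<open>two_way_distances\<close> of a weakly distance-regular digraph.
\<close>
definition intersection_number ::
    "'a pair_pre_digraph \<Rightarrow> nat \<times> nat \<Rightarrow> nat \<times> nat \<Rightarrow> nat \<times> nat \<Rightarrow> nat" where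
  "intersection_number G h i j =
     (THE n. \<forall>x\<in>pverts G. \<forall>y\<in>pverts G.
        two_way_distance G x y = h \<longrightarrow> card (P_set G i j x y) = n)"

locale commutative_weakly_distance_regular_digraph = weakly_distance_regular_digraph +
  assumes commutative:
    "\<lbrakk>h \<in> two_way_distances G; i \<in> two_way_distances G; j \<in> two_way_distances G\<rbrakk>
     \<Longrightarrow> intersection_number G h i j = intersection_number G h j i"

definition Cay :: "'g::ab_group_add set \<Rightarrow> 'g pair_pre_digraph" where
  "Cay C = \<lparr>pverts = UNIV, parcs = {(g, g + c) | g c. c \<in> C}\<rparr>"

text \<open>
  Here and below \<open>4\<close> in a type position is the type of integers modulo \<open>4\<close>
  with its ring structure; the group operations on pairs are componentwise.
\<close>
definition shrikhande_graph :: "(4 \<times> 4) pair_pre_digraph" where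
  "shrikhande_graph = Cay {(1, 0), (-1, 0), (0, 1), (0, -1), (1, 1), (-1, -1)}"

text \<open>The Hamming graph \<open>H(d, 4)\<close>, with \<open>d\<close>-tuples represented by lists of length \<open>d\<close>.\<close>
definition hamming_graph :: "nat \<Rightarrow> 4 list pair_pre_digraph" where
  "hamming_graph d =
     \<lparr>pverts = {xs. length xs = d},
      parcs = {(xs, ys). length xs = d \<and> length ys = d \<and> card {i. i < d \<and> xs ! i \<noteq> ys ! i} = 1}\<rparr>"

definition cartesian_product ::
    "'a pair_pre_digraph \<Rightarrow> 'b pair_pre_digraph \<Rightarrow> ('a \<times> 'b) pair_pre_digraph" where
  "cartesian_product G H =
     \<lparr>pverts = pverts G \<times> pverts H,
      parcs = {((u, v), (u', v')) | u v u' v'.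
        u \<in> pverts G \<and> u' \<in> pverts G \<and> v \<in> pverts H \<and> v' \<in> pverts H \<and>
        (u = u' \<and> (v, v') \<in> parcs H \<or> (u, u') \<in> parcs G \<and> v = v')}\<rparr>"

text \<open>
  The Cartesian product of \<open>n\<close> copies of a graph.  To keep the type independent of \<open>n\<close>,
  a vertex \<open>(u, us)\<close> of the product with the next copy is renamed to \<open>u # us\<close>; the
  empty product is the graph with one vertex.
\<close>
primrec cartesian_power :: "'a pair_pre_digraph \<Rightarrow> nat \<Rightarrow> 'a list pair_pre_digraph" where
  "cartesian_power G 0 = \<lparr>pverts = {[]}, parcs = {}\<rparr>"
| "cartesian_power G (Suc n) =
     \<lparr>pverts = {u # us | u us. (u, us) \<in> pverts (cartesian_product G (cartesian_power G n))},
      parcs = {(u # us, v # vs) | u us v vs.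
        ((u, us), (v, vs)) \<in> parcs (cartesian_product G (cartesian_power G n))}\<rparr>"

definition doob_graph :: "nat \<Rightarrow> nat \<Rightarrow> (4 list \<times> (4 \<times> 4) list) pair_pre_digraph" where
  "doob_graph d1 d2 = cartesian_product (hamming_graph d2) (cartesian_power shrikhande_graph d1)"

end

theory Submission
  imports Defs
begin

text \<open>
  Work with the labels \<open>(\<partial>(x, y), \<partial>(y, x))\<close> on the edges of the underlying Doob graph.  Two distinct
  vertices of a Doob graph have at most two common neighbours, so commutativity forces every square
  either to carry equal labels on opposite sides or to be a directed 4-cycle of a single label.
  Inside a Shrikhande coordinate the second kind of parallelogram is impossible, hence labels are
  translation invariant there.  Pairs with label \<open>(2, 2)\<close> must look alike, which excludes undirected
  edges next to directed ones and leaves only directed triangles, with labels \<open>(1, 2)\<close> and \<open>(2, 1)\<close>.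
  Finally, a further coordinate, complete or Shrikhande, produces a pair with label \<open>(3, 3)\<close> whose
  two-step paths differ from those of a pair with this label inside one Shrikhande coordinate.
\<close>

section \<open>Two-way distances and squares\<close>

text \<open>Weak distance-regularity and commutativity enter only through the question which
  intersection numbers are nonzero: \<open>transfer_raw\<close> carries a midpoint from one pair to
  every pair with the same label, and \<open>commute_raw\<close> exchanges the labels of its two
  halves. Bare existence suffices because of the bound of two common neighbours: a midpoint adjacent
  to both ends must be one of two vertices that are usually known. The label (2, 2) matters because
  generators of the Shrikhande graph have order four. A double step is halfway round a 4-cycle, so
  it has this label whether its steps are directed or not. Inside a Shrikhande coordinate, (3, 3)
  belongs to opposite corners of a square whose two paths each use one arc forwards and one
  backwards, which leaves no directed path of length two. The connection set (1, 0), (0, 1), (-1,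
  -1) is one of the two zero-sum triples of generators; negation maps it to the other.\<close>

locale distance_scheme =
  fixes V :: "'v set" and d :: "'v \<Rightarrow> 'v \<Rightarrow> nat"
  assumes d_eq_0_iff: "\<lbrakk>x \<in> V; y \<in> V\<rbrakk> \<Longrightarrow> d x y = 0 \<longleftrightarrow> x = y"
    and d_triangle: "\<lbrakk>x \<in> V; y \<in> V; z \<in> V\<rbrakk> \<Longrightarrow> d x z \<le> d x y + d y z"
    and d_midpoint: "\<lbrakk>x \<in> V; z \<in> V; d x z = 2\<rbrakk> \<Longrightarrow> \<exists>y\<in>V. d x y = 1 \<and> d y z = 1"
    and transfer_raw: "\<lbrakk>x \<in> V; y \<in> V; x' \<in> V; y' \<in> V; z \<in> V; d x y = d x' y'; d y x = d y' x'\<rbrakk> \<Longrightarrow>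
      \<exists>z'\<in>V. (d x' z', d z' x') = (d x z, d z x) \<and> (d z' y', d y' z') = (d z y, d y z)"
    and commute_raw: "\<lbrakk>x \<in> V; y \<in> V; z \<in> V\<rbrakk> \<Longrightarrow>
      \<exists>z'\<in>V. (d x z', d z' x) = (d z y, d y z) \<and> (d z' y, d y z') = (d x z, d z x)"
    and common_neighbours_raw: "\<lbrakk>x \<in> V; z \<in> V; x \<noteq> z; y1 \<in> V; y2 \<in> V; y3 \<in> V;
      \<And>y. y \<in> {y1, y2, y3} \<Longrightarrow> (d x y = 1 \<or> d y x = 1) \<and> (d y z = 1 \<or> d z y = 1)\<rbrakk> \<Longrightarrow>
      y1 = y2 \<or> y1 = y3 \<or> y2 = y3"
begin

definition rel :: "'v \<Rightarrow> 'v \<Rightarrow> nat \<times> nat" where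
  "rel x y = (d x y, d y x)"

definition adj :: "'v \<Rightarrow> 'v \<Rightarrow> bool" where
  "adj x y \<longleftrightarrow> d x y = 1 \<or> d y x = 1"

lemma swap_rel [simp]: "prod.swap (rel x y) = rel y x"
  by (simp add: rel_def)

lemma rel_flip: "rel x y = rel u v \<Longrightarrow> rel y x = rel v u"
  by (simp add: rel_def)

lemma adj_sym: "adj x y \<Longrightarrow> adj y x"
  by (auto simp: adj_def)

lemma adj_rel: "rel x y = rel u v \<Longrightarrow> adj x y \<longleftrightarrow> adj u v"
  by (simp add: adj_def rel_def)

lemma adj_iff_rel: "adj x y \<longleftrightarrow> fst (rel x y) = 1 \<or> snd (rel x y) = 1"
  by (simp add: adj_def rel_def)

lemma rel_same: "x \<in> V \<Longrightarrow> rel x x = (0, 0)"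
  by (simp add: rel_def d_eq_0_iff)

lemma not_adj_same: "x \<in> V \<Longrightarrow> \<not> adj x x"
  using d_eq_0_iff[of x x] by (simp add: adj_def)

lemma transfer:
  assumes "rel x y = rel x' y'" "x \<in> V" "y \<in> V" "x' \<in> V" "y' \<in> V" "z \<in> V"
  obtains z' where "z' \<in> V" "rel x' z' = rel x z" "rel z' y' = rel z y"
  using transfer_raw[of x y x' y' z] assms by (auto simp: rel_def)

lemma commute:
  assumes "x \<in> V" "y \<in> V" "z \<in> V"
  obtains z' where "z' \<in> V" "rel x z' = rel z y" "rel z' y = rel x z"
  using commute_raw[of x y z] assms by (auto simp: rel_def)

lemma common_neighbours:
  assumes "x \<in> V" "z \<in> V" "x \<noteq> z" "y \<in> V" "w \<in> V" "t \<in> V"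
    and "adj x y" "adj y z" "adj x w" "adj w z" "adj x t" "adj t z" "y \<noteq> w"
  shows "t = y \<or> t = w"
  using common_neighbours_raw[of x z y w t] assms by (auto simp: adj_def)

text \<open>Exchanging the two halves of a path must send each of the midpoints \<open>y\<close> and
  \<open>w\<close> to one of the two. If some midpoint goes to the other one, opposite sides get
  equal labels; if both stay, each path repeats a single label.\<close>

lemma two_path:
  assumes V: "x \<in> V" "z \<in> V" "y \<in> V" "w \<in> V" and "x \<noteq> z" "y \<noteq> w"
    and adj: "adj x y" "adj y z" "adj x w" "adj w z"
  shows "rel x y = rel w z \<and> rel y z = rel x w \<or> rel x y = rel y z \<and> rel x w = rel w z"
proof -
  have *: "rel t z = rel x s \<or> rel x s = rel s z"
    if s: "s \<in> V" "t \<in> V" "adj x s" "adj s z" "adj x t" "adj t z" "s \<noteq> t"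
      and "rel x t \<noteq> rel s z \<or> rel t z \<noteq> rel x s" for s t
  proof -
    obtain s' where "s' \<in> V" "rel x s' = rel s z" "rel s' z = rel x s"
      using commute[of x z s] V s by metis
    moreover have "adj x s'" "adj s' z"
      using calculation s adj_rel by metis+
    ultimately show ?thesis
      using common_neighbours[of x z s t s'] V s \<open>x \<noteq> z\<close> by metis
  qed
  obtain s where s: "s \<in> V" "rel x s = rel y z" "rel s z = rel x y"
    using commute[of x z y] V by metis
  have "adj x s" "adj s z"
    using s adj adj_rel by metis+
  then have "s = y \<or> s = w"
    using common_neighbours[of x z y w s] V s adj assms(5,6) by metis
  moreover obtain t where t: "t \<in> V" "rel x t = rel w z" "rel t z = rel x w"
    using commute[of x z w] V by metis
  have "adj x t" "adj t z"
    using t adj adj_rel by metis+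
  then have "t = y \<or> t = w"
    using common_neighbours[of x z y w t] V t adj assms(5,6) by metis
  ultimately show ?thesis
    using s t by metis
qed

text \<open>\<open>two_path\<close> applies at both diagonals. If neither application equates
  opposite sides, then labels agree at every corner, which carries one label all the way
  round.\<close>

lemma square:
  assumes V: "x \<in> V" "y \<in> V" "z \<in> V" "w \<in> V" and "x \<noteq> z" "y \<noteq> w"
    and adj: "adj x y" "adj y z" "adj z w" "adj w x"
  shows "rel x y = rel w z \<and> rel y z = rel x w \<or>
    rel x y = rel y z \<and> rel y z = rel z w \<and> rel z w = rel w x"
proof -
  have 1: "rel x y = rel w z \<and> rel y z = rel x w \<or> rel x y = rel y z \<and> rel x w = rel w z"
    using two_path[of x z y w] assms adj_sym by metis
  have 2: "rel y z = rel x w \<and> rel z w = rel y x \<or> rel y z = rel z w \<and> rel y x = rel x w"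
    using two_path[of y w z x] assms adj_sym by metis
  show ?thesis
    using 1 2 rel_flip by metis
qed

text \<open>The edge \<open>x y\<close> has at most two common neighbours, yet exchange and transfer
  produce several; their labels clash unless the diagonal is undirected. An undirected diagonal in
  turn gives the return path \<open>y\<close>, \<open>z\<close>, \<open>x\<close> of length
  two.\<close>

lemma cyclic_square_diagonal:
  assumes V: "x \<in> V" "y \<in> V" "z \<in> V" "w \<in> V" and "y \<noteq> w"
    and cyc: "rel x y = rel y z" "rel y z = rel z w" "rel z w = rel w x"
    and adj: "d x y = 1" "adj x z"
    and nsym: "rel x y \<noteq> rel y x"
  shows "rel x z = (1, 1)" "rel x y = (1, 2)"
proof -
  have e: "adj x y" "adj y z" "adj z w" "adj w x"
    using adj cyc adj_rel by (metis adj_def)+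
  have ne: "x \<noteq> y" "z \<noteq> w"
    using e not_adj_same V by metis+
  \<comment> \<open>Write a for \<open>rel x y\<close>, b for \<open>rel x z\<close> and a prime for
    reversal. As midpoints between \<open>x\<close> and \<open>y\<close>, the vertices
    \<open>z\<close>, \<open>t\<close>, \<open>s\<close>, \<open>r\<close> carry the label pairs (b,
    a'), (a', b), (b', a'), (a', b').\<close>
  obtain t where t: "t \<in> V" "rel x t = rel z y" "rel t y = rel x z"
    using commute[of x y z] V by metis
  obtain s where s: "s \<in> V" "rel x s = rel z x" "rel s y = rel x w"
    using transfer[of z w x y x] V cyc by metis
  obtain r where r: "r \<in> V" "rel x r = rel s y" "rel r y = rel x s"
    using commute[of x y s] V s by metis
  have e': "adj x t" "adj t y" "adj x s" "adj s y" "adj x r" "adj r y"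
    using t s r e adj adj_rel adj_sym by metis+
  have 0: "rel x z = rel z x"
  proof (rule ccontr)
    assume n: "rel x z \<noteq> rel z x"
    have "z \<noteq> s"
      using n s by metis
    then have "t = z \<or> t = s" "r = z \<or> r = s"
      using common_neighbours[of x y z s] V t s r e e' adj ne adj_sym by metis+
    then show False
      using n t s r cyc nsym rel_flip by metis
  qed
  then show 1: "rel x z = (1, 1)"
    using adj by (metis adj_def rel_def fst_conv)
  have "d y x \<le> d y z + d z x"
    using d_triangle V by blast
  then have "d y x \<le> 2"
    using 1 cyc adj by (simp add: rel_def)
  moreover have "d y x \<noteq> 1"
    using nsym adj by (auto simp: rel_def)
  moreover have "d y x \<noteq> 0"
    using ne V d_eq_0_iff by metis
  ultimately show "rel x y = (1, 2)"
    using adj by (simp add: rel_def)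
qed

lemma rel_2_2I:
  assumes "x \<in> V" "y \<in> V" "y' \<in> V" "z \<in> V" "x \<noteq> z" "\<not> adj x z"
    and "d x y = 1" "d y z = 1" "d z y' = 1" "d y' x = 1"
  shows "rel x z = (2, 2)"
proof -
  have "d x z \<le> 2" "d z x \<le> 2"
    using d_triangle[of x y z] d_triangle[of z y' x] assms by auto
  moreover have "d x z \<noteq> 0" "d z x \<noteq> 0" "d x z \<noteq> 1" "d z x \<noteq> 1"
    using assms d_eq_0_iff by (auto simp: adj_def)
  ultimately show ?thesis
    by (simp add: rel_def)
qed

text \<open>Transferring \<open>y'\<close> gives a second midpoint \<open>s\<close> of
  \<open>x z\<close>. The resulting square has undirected sides at \<open>y\<close> and directed
  ones at \<open>s\<close>, which neither outcome of \<open>square\<close> allows.\<close>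

lemma no_mixed_2_2:
  assumes V: "x \<in> V" "y \<in> V" "z \<in> V" "x' \<in> V" "y' \<in> V" "z' \<in> V"
    and U: "rel x y = (1, 1)" "rel y z = (1, 1)" "rel x z = (2, 2)"
    and Q: "rel x' y' = rel y' z'" "adj x' y'" "rel x' y' \<noteq> rel y' x'" "rel x' z' = (2, 2)"
  shows False
proof -
  obtain s where s: "s \<in> V" "rel x s = rel x' y'" "rel s z = rel y' z'"
    using transfer[of x' z' x z y'] V U Q by metis
  have e: "adj x s" "adj s z" "adj x y" "adj y z"
    using s Q adj_rel U by (metis adj_iff_rel fst_conv)+
  have ne: "x \<noteq> z" "y \<noteq> s"
    using U V rel_same[of x] s Q by (auto simp: rel_def)
  show False
    using square[of x y z s] V s(1) e ne U s Q rel_flip adj_sym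
    by (metis prod.swap_def swap_rel fst_conv snd_conv)
qed

end

section \<open>The generators of the Shrikhande graph\<close>

definition shrikhande_gens :: "(4 \<times> 4) set" where
  "shrikhande_gens = {(1, 0), (-1, 0), (0, 1), (0, -1), (1, 1), (-1, -1)}"

lemma all_4: "(\<forall>m::4. P m) \<longleftrightarrow> P 0 \<and> P 1 \<and> P 2 \<and> P 3"
proof -
  have "m = 0 \<or> m = 1 \<or> m = 2 \<or> m = 3" for m :: 4
  proof (rule bit0_induct[of _ m])
    fix z :: int
    assume "0 \<le> z" "z < int CARD(4)"
    then have "z = 0 \<or> z = 1 \<or> z = 2 \<or> z = 3"
      by auto
    then show "(of_int z :: 4) = 0 \<or> (of_int z :: 4) = 1 \<or> (of_int z :: 4) = 2 \<or> (of_int z :: 4) = 3"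
      by auto
  qed
  then show ?thesis
    by metis
qed

lemma induct_4:
  fixes m :: 4
  assumes "P 0" "\<And>m. P m \<Longrightarrow> P (m + 1)"
  shows "P m"
  using assms(1) assms(2)[of 0] assms(2)[of 1] assms(2)[of 2] all_4[of P] by simp

lemma shrikhande_gens_at_most_two:
  assumes "D \<noteq> 0" "u \<in> shrikhande_gens" "v \<in> shrikhande_gens" "w \<in> shrikhande_gens"
    "D - u \<in> shrikhande_gens" "D - v \<in> shrikhande_gens" "D - w \<in> shrikhande_gens"
  shows "u = v \<or> u = w \<or> v = w"
proof -
  have "\<forall>D1 D2. (D1, D2) \<noteq> (0::4\<times>4) \<longrightarrow> (\<forall>u\<in>shrikhande_gens. (D1, D2) - u \<in> shrikhande_gens \<longrightarrow>
    (\<forall>v\<in>shrikhande_gens. (D1, D2) - v \<in> shrikhande_gens \<longrightarrow> u = v \<or>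
    (\<forall>w\<in>shrikhande_gens. (D1, D2) - w \<in> shrikhande_gens \<longrightarrow> u = w \<or> v = w)))"
    unfolding shrikhande_gens_def by (simp add: all_4 zero_prod_def)
  then show ?thesis
    using assms by (metis surj_pair)
qed

lemma zero_notin_gens: "0 \<notin> shrikhande_gens"
  by (simp add: shrikhande_gens_def zero_prod_def)

lemma uminus_gens_iff [simp]: "- g \<in> shrikhande_gens \<longleftrightarrow> g \<in> shrikhande_gens"
proof -
  have "\<forall>m n. - (m, n) \<in> shrikhande_gens \<longleftrightarrow> (m, n) \<in> shrikhande_gens"
    by (simp add: shrikhande_gens_def all_4)
  then show ?thesis
    by (metis surj_pair)
qed

lemma gens_double:
  assumes "g \<in> shrikhande_gens"
  shows "g + g \<notin> shrikhande_gens" "g + g \<noteq> 0" "g \<noteq> - g" "g + (g + g) = - g"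
proof -
  have "\<forall>g\<in>shrikhande_gens. g + g \<notin> shrikhande_gens \<and> g + g \<noteq> 0 \<and> g \<noteq> - g \<and> g + (g + g) = - g"
    unfolding shrikhande_gens_def by (simp add: zero_prod_def)
  then show "g + g \<notin> shrikhande_gens" "g + g \<noteq> 0" "g \<noteq> - g" "g + (g + g) = - g"
    using assms by blast+
qed

text \<open>The two sums are the diagonals of the parallelogram spanned by \<open>g\<close> and
  \<open>h\<close>: exactly one diagonal is an edge, so an argument that needs such a diagonal
  always has one to work with.\<close>

lemma gens_independent:
  assumes "g \<in> shrikhande_gens" "h \<in> shrikhande_gens" "h \<noteq> g" "h \<noteq> - g"
  shows "g + h \<in> shrikhande_gens \<and> g - h \<notin> shrikhande_gens \<or>
    g - h \<in> shrikhande_gens \<and> g + h \<notin> shrikhande_gens"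
proof -
  have "\<forall>g\<in>shrikhande_gens. \<forall>h\<in>shrikhande_gens. h \<noteq> g \<longrightarrow> h \<noteq> - g \<longrightarrow>
    g + h \<in> shrikhande_gens \<and> g - h \<notin> shrikhande_gens \<or>
    g - h \<in> shrikhande_gens \<and> g + h \<notin> shrikhande_gens"
    unfolding shrikhande_gens_def by (simp add: zero_prod_def)
  then show ?thesis
    using assms by blast
qed

lemma gens_zero_sum:
  assumes "g \<in> shrikhande_gens"
  obtains h k where "h \<in> shrikhande_gens" "k \<in> shrikhande_gens" "h \<noteq> k" "g + h + k = 0"
proof -
  obtain m n where g: "g = (m, n)"
    by fastforce
  \<comment> \<open>The linear map taking (m, n) to (- n, m - n) has order three and permutes the
    generators; \<open>h\<close> and \<open>k\<close> are the two further images of \<open>g\<close>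
    under it, and each orbit sums to zero.\<close>
  have "(- n, m - n) \<in> shrikhande_gens" "(n - m, - m) \<in> shrikhande_gens" "(- n, m - n) \<noteq> (n - m, - m)"
    using assms unfolding g shrikhande_gens_def by (elim insertE; simp)+
  moreover have "g + (- n, m - n) + (n - m, - m) = 0"
    by (simp add: g zero_prod_def)
  ultimately show ?thesis
    using that by blast
qed

text \<open>Serves to spread the label of a \<open>g\<close> edge over all translates: translation
  along \<open>h\<close> is controlled only for \<open>h\<close> other than \<open>g\<close> and
  \<open>- g\<close>, and the remaining four generators still reach the whole group.\<close>

lemma gens_generate:
  assumes g: "g \<in> shrikhande_gens" and 0: "P 0"
    and step: "\<And>p h. \<lbrakk>P p; h \<in> shrikhande_gens; h \<noteq> g; h \<noteq> - g\<rbrakk> \<Longrightarrow> P (p + h)"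
  shows "P p"
proof -
  obtain m n where p: "p = (m, n)"
    by fastforce
  have s: "P (m, n) \<Longrightarrow> P (m + h1, n + h2)"
    if "(h1, h2) \<in> shrikhande_gens" "(h1, h2) \<noteq> g" "(h1, h2) \<noteq> - g" for h1 h2 m n
    using step[of "(m, n)" "(h1, h2)"] that by simp
  have z: "P (0, 0)"
    using 0 by (simp add: zero_prod_def)
  consider "g = (1, 0) \<or> g = (-1, 0)" | "g = (0, 1) \<or> g = (0, -1)" | "g = (1, 1) \<or> g = (-1, -1)"
    using g unfolding shrikhande_gens_def by blast
  then show ?thesis
  proof cases
    case 1
    have 1: "P (m, n) \<Longrightarrow> P (m + 1, n + 1)" "P (m, n) \<Longrightarrow> P (m, n + 1)" for m n
      using s[of 1 1 m n] s[of 0 1 m n] 1 by (auto simp: shrikhande_gens_def)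
    have "P (m, m)"
      by (induction m rule: induct_4) (use z 1 in auto)
    then have "P (m, m + k)" for k
      by (induction k rule: induct_4) (use 1(2)[of m "m + _"] in \<open>auto simp only: add.assoc add_0_right\<close>)
    from this[of "n - m"] show ?thesis
      by (simp add: p)
  next
    case 2
    have 2: "P (m, n) \<Longrightarrow> P (m + 1, n + 1)" "P (m, n) \<Longrightarrow> P (m + 1, n)" for m n
      using s[of 1 1 m n] s[of 1 0 m n] 2 by (auto simp: shrikhande_gens_def)
    have "P (n, n)"
      by (induction n rule: induct_4) (use z 2 in auto)
    then have "P (n + k, n)" for k
      by (induction k rule: induct_4) (use 2(2)[of "n + _" n] in \<open>auto simp only: add.assoc add_0_right\<close>)
    from this[of "m - n"] show ?thesis
      by (simp add: p)
  next
    case 3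
    have 3: "P (m, n) \<Longrightarrow> P (m + 1, n)" "P (m, n) \<Longrightarrow> P (m, n + 1)" for m n
      using s[of 1 0 m n] s[of 0 1 m n] 3 by (auto simp: shrikhande_gens_def)
    have "P (m, 0)"
      by (induction m rule: induct_4) (use z 3 in auto)
    then have "P (m, n)"
      by (induction n rule: induct_4) (use 3 in auto)
    then show ?thesis
      by (simp add: p)
  qed
qed

section \<open>Doob graphs on functions\<close>

text \<open>One coordinate type serves every \<open>d1\<close> and \<open>d2\<close>: a clique
  coordinate keeps its four values in the first component, and coordinates from
  \<open>d1 + d2\<close> on are frozen at zero.\<close>

definition fibre :: "nat \<Rightarrow> nat \<Rightarrow> nat \<Rightarrow> (4 \<times> 4) set" where
  "fibre d1 d2 i = (if i < d1 then UNIV else if i < d1 + d2 then UNIV \<times> {0} else {0})"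

definition doob_verts :: "nat \<Rightarrow> nat \<Rightarrow> (nat \<Rightarrow> 4 \<times> 4) set" where
  "doob_verts d1 d2 = {x. \<forall>i. x i \<in> fibre d1 d2 i}"

definition fibre_adj :: "nat \<Rightarrow> nat \<Rightarrow> 4 \<times> 4 \<Rightarrow> 4 \<times> 4 \<Rightarrow> bool" where
  "fibre_adj d1 i p q \<longleftrightarrow> p \<noteq> q \<and> (i < d1 \<longrightarrow> q - p \<in> shrikhande_gens)"

definition doob_adj :: "nat \<Rightarrow> (nat \<Rightarrow> 4 \<times> 4) \<Rightarrow> (nat \<Rightarrow> 4 \<times> 4) \<Rightarrow> bool" where
  "doob_adj d1 x y \<longleftrightarrow> (\<exists>i. fibre_adj d1 i (x i) (y i) \<and> (\<forall>j. j \<noteq> i \<longrightarrow> x j = y j))"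

text \<open>In a Shrikhande coordinate this counts the ways to split \<open>q - p\<close> into two
  generators; in a clique coordinate five distinct vertices would have to fit among four.\<close>

lemma fibre_common_neighbours:
  assumes "p \<in> fibre d1 d2 i" "q \<in> fibre d1 d2 i" "p \<noteq> q"
    and r: "r1 \<in> fibre d1 d2 i" "r2 \<in> fibre d1 d2 i" "r3 \<in> fibre d1 d2 i"
    and adj: "\<And>r. r \<in> {r1, r2, r3} \<Longrightarrow> fibre_adj d1 i p r \<and> fibre_adj d1 i r q"
  shows "r1 = r2 \<or> r1 = r3 \<or> r2 = r3"
proof (cases "i < d1")
  case True
  have "q - r = (q - p) - (r - p)" for r
    by simp
  then have "r - p \<in> shrikhande_gens \<and> (q - p) - (r - p) \<in> shrikhande_gens"
    if "r \<in> {r1, r2, r3}" for r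
    using adj[OF that] True by (auto simp: fibre_adj_def)
  then have "r1 - p = r2 - p \<or> r1 - p = r3 - p \<or> r2 - p = r3 - p"
    using shrikhande_gens_at_most_two[of "q - p" "r1 - p" "r2 - p" "r3 - p"] \<open>p \<noteq> q\<close>
      by simp
  then show ?thesis
    by simp
next
  case False
  show ?thesis
  proof (rule ccontr)
    assume "\<not> ?thesis"
    moreover have "p \<noteq> r" "r \<noteq> q" if "r \<in> {r1, r2, r3}" for r
      using adj[OF that] by (auto simp: fibre_adj_def)
    from this[of r1] this[of r2] this[of r3] have "p \<notin> {r1, r2, r3}" "q \<notin> {r1, r2, r3}"
      by auto
    ultimately have "card {p, q, r1, r2, r3} = 5"
      using \<open>p \<noteq> q\<close> by simp
    moreover have "card {p, q, r1, r2, r3} \<le> card (UNIV \<times> {0} :: (4 \<times> 4) set)"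
      using assms False by (intro card_mono) (auto simp: fibre_def split: if_splits)
    ultimately show False
      by (simp add: card_cartesian_product)
  qed
qed

text \<open>The two steps change coordinates \<open>k\<close> and \<open>l\<close>. If these agree,
  the path stays inside one fibre; otherwise each coordinate gets its final value in a single step,
  and only the order of the steps is free.\<close>

lemma doob_common_neighbour_cases:
  assumes "doob_adj d1 x y" "doob_adj d1 y z" and ne: "x i \<noteq> z i"
  shows "(y = x(i := y i) \<and> z = x(i := z i) \<and> fibre_adj d1 i (x i) (y i) \<and> fibre_adj d1 i (y i) (z i)) \<or>
    (\<exists>j. j \<noteq> i \<and> x j \<noteq> z j \<and> z = x(i := z i, j := z j) \<and> fibre_adj d1 i (x i) (z i) \<and> fibre_adj d1 j (x j) (z j)
      \<and> (y = x(i := z i) \<or> y = x(j := z j)))"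
proof -
  obtain k where k: "fibre_adj d1 k (x k) (y k)" "\<And>j. j \<noteq> k \<Longrightarrow> x j = y j"
    using assms(1) by (auto simp: doob_adj_def)
  obtain l where l: "fibre_adj d1 l (y l) (z l)" "\<And>j. j \<noteq> l \<Longrightarrow> y j = z j"
    using assms(2) by (auto simp: doob_adj_def)
  have y: "y = x(k := y k)" and z: "z = y(l := z l)"
    using k(2) l(2) by (auto simp: fun_eq_iff)
  show ?thesis
  proof (cases "k = l")
    case True
    then have "k = i"
      using ne k(2) l(2) by metis
    then show ?thesis
      using True k l y z by (metis fun_upd_upd)
  next
    case False
    have k': "y k = z k" and l': "x l = y l"
      using k(2) l(2) False by auto
    have *: "fibre_adj d1 k (x k) (z k)" "fibre_adj d1 l (x l) (z l)" "x k \<noteq> z k" "x l \<noteq> z l"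
      using k(1) l(1) k' l' by (auto simp: fibre_adj_def)
    have "i = k \<or> i = l"
      using ne k(2) l(2) by metis
    then show ?thesis
      using False * k' y z by (metis fun_upd_twist)
  qed
qed

lemma doob_common_neighbours:
  assumes V: "x \<in> doob_verts d1 d2" "z \<in> doob_verts d1 d2" "x \<noteq> z"
      "y1 \<in> doob_verts d1 d2" "y2 \<in> doob_verts d1 d2" "y3 \<in> doob_verts d1 d2"
    and adj: "\<And>y. y \<in> {y1, y2, y3} \<Longrightarrow> doob_adj d1 x y \<and> doob_adj d1 y z"
  shows "y1 = y2 \<or> y1 = y3 \<or> y2 = y3"
proof -
  obtain i where i: "x i \<noteq> z i"
    using V(3) by (auto simp: fun_eq_iff)
  have f: "w i \<in> fibre d1 d2 i" if "w \<in> doob_verts d1 d2" for w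
    using that by (auto simp: doob_verts_def)
  show ?thesis
  proof (cases "z = x(i := z i)")
    case True
    then have z: "j \<noteq> i \<Longrightarrow> z j = x j" for j
      by (metis fun_upd_other)
    have *: "y = x(i := y i) \<and> fibre_adj d1 i (x i) (y i) \<and> fibre_adj d1 i (y i) (z i)"
      if "y \<in> {y1, y2, y3}" for y
      using doob_common_neighbour_cases[of d1 x y z i] adj[OF that] i z by metis
    have "y1 i = y2 i \<or> y1 i = y3 i \<or> y2 i = y3 i"
      using f V i * by (intro fibre_common_neighbours[of "x i" d1 d2 i "z i"]) auto
    moreover have "y1 = x(i := y1 i)" "y2 = x(i := y2 i)" "y3 = x(i := y3 i)"
      using * by blast+
    ultimately show ?thesis
      by metis
  next
    case False
    have 1: "\<exists>j. j \<noteq> i \<and> x j \<noteq> z j \<and> z = x(i := z i, j := z j) \<and> (y = x(i := z i) \<or> y = x(j := z j))"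
      if "y \<in> {y1, y2, y3}" for y
      using doob_common_neighbour_cases[of d1 x y z i] adj[OF that] i False by metis
    then obtain j where j: "j \<noteq> i" "x j \<noteq> z j" "z = x(i := z i, j := z j)"
      by blast
    have "k = j" if "k \<noteq> i" "x k \<noteq> z k" for k
      using j that by (metis fun_upd_other)
    then have "y = x(i := z i) \<or> y = x(j := z j)" if "y \<in> {y1, y2, y3}" for y
      using 1[OF that] by metis
    from this[of y1] this[of y2] this[of y3] show ?thesis
      by auto
  qed
qed

text \<open>With two coordinates to change and two steps available, the change in each coordinate
  would have to be an edge of its fibre.\<close>

lemma no_common_neighbour:
  assumes "x i \<noteq> z i" "x j \<noteq> z j" "i \<noteq> j" "\<not> fibre_adj d1 i (x i) (z i)"
  shows "\<not> (doob_adj d1 x y \<and> doob_adj d1 y z)"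
proof
  assume "doob_adj d1 x y \<and> doob_adj d1 y z"
  then show False
    using doob_common_neighbour_cases[of d1 x y z i] assms by (metis fun_upd_other)
qed

lemma doob_adj_diff:
  assumes "doob_adj d1 x y" "x i \<noteq> y i" "x j \<noteq> y j"
  shows "i = j"
  using assms unfolding doob_adj_def by metis

section \<open>Labels in a Shrikhande coordinate\<close>

definition shift :: "(nat \<Rightarrow> 'g::ab_group_add) \<Rightarrow> nat \<Rightarrow> 'g \<Rightarrow> nat \<Rightarrow> 'g" where
  "shift x i p = x(i := x i + p)"

lemma shift_simps [simp]:
  "shift x i 0 = x"
  "shift (shift x i p) i q = shift x i (p + q)"
  "shift x i p = shift x i q \<longleftrightarrow> p = q"
  "shift x i p i = x i + p"
  "j \<noteq> i \<Longrightarrow> shift x i p j = x j"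
  by (auto simp: shift_def add.assoc fun_upd_idem_iff dest: fun_upd_eqD)

lemma shift_eq_self_iff [simp]: "shift x i p = x \<longleftrightarrow> p = 0" "x = shift x i p \<longleftrightarrow> p = 0"
  using shift_simps(3)[of x i p 0] by auto

lemma shift_swap: "i \<noteq> j \<Longrightarrow> shift (shift x i p) j q = shift (shift x j q) i p"
  by (simp add: shift_def fun_upd_twist)

lemma gens_triangle:
  assumes g: "g \<in> shrikhande_gens" and h: "h \<in> shrikhande_gens" and gh: "g + h \<in> shrikhande_gens"
  shows "g \<noteq> h" "g \<noteq> 0" "h \<noteq> 0" "g + h \<noteq> - h" "g \<noteq> - (g + h)" "h - g \<notin> shrikhande_gens"
proof -
  \<comment> \<open>Such a relation would make the double of \<open>b\<close> a generator.\<close>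
  have *: False if "a \<in> shrikhande_gens" "b \<in> shrikhande_gens" "a + (b + b) = 0" for a b
  proof -
    have "b + b = - a"
      using that(3) by (metis add.commute eq_neg_iff_add_eq_0)
    then show False
      using that gens_double(1) uminus_gens_iff by metis
  qed
  show 1: "g \<noteq> h" "g \<noteq> 0" "h \<noteq> 0"
    using assms gens_double(1) zero_notin_gens by metis+
  show "g + h \<noteq> - h"
    using *[OF g h] by (metis add.assoc ab_left_minus)
  show "g \<noteq> - (g + h)"
    using *[OF h g] by (metis add.assoc add.commute add.right_inverse)
  have "h \<noteq> - g"
    using gh zero_notin_gens by auto
  then have "g - h \<notin> shrikhande_gens"
    using gens_independent[OF g h] 1 gh by blast
  then show "h - g \<notin> shrikhande_gens"
    by (metis minus_diff_eq uminus_gens_iff)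
qed

section \<open>Translation invariance of labels inside a Shrikhande coordinate\<close>

locale doob_scheme = distance_scheme "doob_verts d1 d2" d for d1 d2 :: nat and d +
  assumes adj_iff_doob_adj_raw:
    "\<lbrakk>x \<in> doob_verts d1 d2; y \<in> doob_verts d1 d2\<rbrakk> \<Longrightarrow> (d x y = 1 \<or> d y x = 1) \<longleftrightarrow> doob_adj d1 x y"
begin

abbreviation "V \<equiv> doob_verts d1 d2"

lemma adj_iff_doob_adj: "\<lbrakk>x \<in> V; y \<in> V\<rbrakk> \<Longrightarrow> adj x y \<longleftrightarrow> doob_adj d1 x y"
  by (simp add: adj_def adj_iff_doob_adj_raw del: One_nat_def)

lemma shift_in_V: "\<lbrakk>x \<in> V; i < d1\<rbrakk> \<Longrightarrow> shift x i p \<in> V"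
proof -
  assume "x \<in> V" "i < d1"
  then have "shift x i p j \<in> fibre d1 d2 j" for j
    by (cases "j = i") (simp_all add: doob_verts_def fibre_def)
  then show ?thesis
    by (simp add: doob_verts_def)
qed

lemma adj_shift:
  assumes "x \<in> V" "i < d1"
  shows "adj (shift x i p) (shift x i q) \<longleftrightarrow> q - p \<in> shrikhande_gens"
proof -
  have "doob_adj d1 (shift x i p) (shift x i q) \<longleftrightarrow> q - p \<in> shrikhande_gens"
    (is "?L \<longleftrightarrow> ?R")
  proof
    assume ?L
    then obtain j where j: "fibre_adj d1 j (shift x i p j) (shift x i q j)"
      by (auto simp: doob_adj_def)
    then have "j = i"
      by (metis fibre_adj_def shift_simps(5))
    then show ?R
      using j assms(2) by (simp add: fibre_adj_def)
  next
    assume ?R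
    then have "fibre_adj d1 i (shift x i p i) (shift x i q i)"
      using zero_notin_gens by (auto simp: fibre_adj_def)
    moreover have "shift x i p j = shift x i q j" if "j \<noteq> i" for j
      using that by simp
    ultimately show ?L
      unfolding doob_adj_def by blast
  qed
  then show ?thesis
    using assms by (simp add: adj_iff_doob_adj shift_in_V)
qed

lemma adj_shift_self:
  assumes "x \<in> V" "i < d1"
  shows "adj x (shift x i q) \<longleftrightarrow> q \<in> shrikhande_gens" "adj (shift x i q) x \<longleftrightarrow> q \<in> shrikhande_gens"
  using adj_shift[OF assms, of 0 q] adj_shift[OF assms, of q 0] by simp_all

text \<open>The labels around \<open>x\<close> continue the pattern of the cyclic parallelogram, so that \<open>x\<close> is the
  middle of two collinear undirected edges, whereas the other diagonal of the parallelogram is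
  spanned by directed edges.\<close>
lemma no_cyclic_parallelogram_aux:
  assumes x: "x \<in> V" "i < d1" and C: "g \<in> shrikhande_gens" "h \<in> shrikhande_gens" "k \<in> shrikhande_gens"
    and k: "k = g + h"
    and cyc: "rel x (shift x i g) = rel (shift x i g) (shift x i k)"
      "rel (shift x i g) (shift x i k) = rel (shift x i k) (shift x i h)"
      "rel (shift x i k) (shift x i h) = rel (shift x i h) x"
    and d: "d x (shift x i g) = 1"
    and nsym: "rel x (shift x i g) \<noteq> rel (shift x i g) x"
  shows False
proof -
  let ?s = "shift x i"
  have V: "x \<in> V" "?s p \<in> V" for p
    using shift_in_V[OF x] x(1) by auto
  note A = adj_shift[OF x] adj_shift_self[OF x]
  have D: "k - g = h" "g - k = - h" "g - - h = k" "- k - - h = - g" "k - - k = k + k"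
    by (simp_all add: k)
  have G: "g \<noteq> h" "k \<noteq> - h" "g \<noteq> - k" "g \<noteq> 0" "- h \<noteq> 0" "h - g \<notin> shrikhande_gens"
    using gens_triangle[of g h] C k by auto
  have A': "adj (?s k) (?s g)" "adj (?s (- h)) (?s g)" "adj (?s g) (?s k)" "adj (?s g) (?s (- h))"
      "adj x (?s k)" "adj (?s k) x" "adj x (?s g)" "adj (?s g) x" "adj x (?s (- h))" "adj (?s (- h)) x"
      "adj (?s (- k)) x" "adj (?s (- h)) (?s (- k))"
    by (simp_all only: A D C uminus_gens_iff) (metis A(1) C(3) D(3) adj_sym)
  have ne: "?s g \<noteq> ?s h" "?s k \<noteq> ?s (- h)" "?s g \<noteq> ?s (- k)" "x \<noteq> ?s g" "?s (- h) \<noteq> x"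
    using G by (simp_all only: shift_simps shift_eq_self_iff not_False_eq_True)
  have U: "rel x (?s k) = (1, 1)" and S: "rel x (?s g) = (1, 2)"
    using cyclic_square_diagonal[OF V(1) V(2) V(2) V(2) ne(1) cyc d A'(5) nsym] by blast+
  have S': "rel (?s k) (?s g) = (2, 1)"
    using S cyc(1) by (simp add: rel_def)
  \<comment> \<open>On the edge from \<open>x\<close> to \<open>?s g\<close>, the midpoint
    \<open>?s k\<close> has labels (1, 1) and (2, 1). Its exchange cannot be \<open>?s k\<close>
    itself, so it is the other common neighbour \<open>?s (- h)\<close>.\<close>
  obtain s where s: "s \<in> V" "rel x s = rel (?s k) (?s g)" "rel s (?s g) = rel x (?s k)"
    using commute[of x "?s g" "?s k"] V by metis
  have "adj x s" "adj s (?s g)"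
    using A' adj_rel[OF s(2)] adj_rel[OF s(3)] by blast+
  then have "s = ?s k \<or> s = ?s (- h)"
    using common_neighbours[OF V(1) V(2) ne(4) V(2) V(2) s(1)] A' ne by blast
  moreover have "s \<noteq> ?s k"
    using s U S' by auto
  ultimately have t: "rel x (?s (- h)) = (2, 1)" "rel (?s (- h)) (?s g) = (1, 1)"
    using s U S' by auto
  \<comment> \<open>The same exchange on the edge from \<open>?s (- h)\<close> to \<open>x\<close>
    replaces the midpoint \<open>?s g\<close> by \<open>?s (- k)\<close> and so makes the edge
    opposite to \<open>?s k\<close> undirected.\<close>
  obtain r where r: "r \<in> V" "rel (?s (- h)) r = rel (?s g) x" "rel r x = rel (?s (- h)) (?s g)"
    using commute[of "?s (- h)" x "?s g"] V by metis
  have "adj (?s (- h)) r" "adj r x"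
    using A' adj_rel[OF r(2)] adj_rel[OF r(3)] by blast+
  then have "r = ?s g \<or> r = ?s (- k)"
    using common_neighbours[OF V(2) V(1) ne(5) V(2) V(2) r(1)] A' ne by blast
  moreover have "r \<noteq> ?s g"
    using r t S by (auto simp: rel_def)
  ultimately have U': "rel (?s (- k)) x = (1, 1)"
    using r t by auto
  have "?s (- k) \<noteq> ?s k" "\<not> adj (?s (- k)) (?s k)"
    using gens_double[OF C(3)] by (simp_all only: A D shift_simps) auto
  then have "rel (?s (- k)) (?s k) = (2, 2)"
    using rel_2_2I[of "?s (- k)" x x "?s k"] V U U' by (simp add: rel_def)
  moreover have "\<not> adj (?s g) (?s h)"
    using G by (simp only: A(1) not_False_eq_True)
  moreover have "d (?s g) (?s k) = 1" "d (?s k) (?s h) = 1" "d (?s h) x = 1"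
    using cyc d by (simp_all add: rel_def)
  ultimately have "rel (?s (- k)) (?s k) = (2, 2)" "rel (?s g) (?s h) = (2, 2)"
    using rel_2_2I[OF V(2) V(2) V(1) V(2) ne(1)] d by blast+
  moreover have "rel (?s g) (?s k) \<noteq> rel (?s k) (?s g)"
    using S' by (auto simp: rel_def)
  ultimately show False
    using no_mixed_2_2[OF V(2) V(1) V(2) V(2) V(2) V(2) U' U _ cyc(2) A'(3)] by blast
qed

text \<open>If the arc between \<open>x\<close> and its \<open>g\<close> translate runs backwards,
  walking round the parallelogram in the other sense exchanges \<open>g\<close> and \<open>h\<close>
  and gives the forward case.\<close>

lemma no_cyclic_parallelogram:
  assumes x: "x \<in> V" "i < d1" and C: "g \<in> shrikhande_gens" "h \<in> shrikhande_gens" "k \<in> shrikhande_gens"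
    and k: "k = g + h"
    and cyc: "rel x (shift x i g) = rel (shift x i g) (shift x i k)"
      "rel (shift x i g) (shift x i k) = rel (shift x i k) (shift x i h)"
      "rel (shift x i k) (shift x i h) = rel (shift x i h) x"
  shows "rel x (shift x i g) = rel (shift x i g) x"
proof (rule ccontr)
  assume nsym: "rel x (shift x i g) \<noteq> rel (shift x i g) x"
  have "adj x (shift x i g)"
    using adj_shift_self(1) x C by blast
  then consider "d x (shift x i g) = 1" | "d (shift x i g) x = 1"
    by (auto simp: adj_def)
  then show False
  proof cases
    case 1
    then show False
      using no_cyclic_parallelogram_aux[OF x C k cyc] nsym by blast
  next
    case 2
    have r: "rel x (shift x i h) = rel (shift x i h) (shift x i k)"
      "rel (shift x i h) (shift x i k) = rel (shift x i k) (shift x i g)"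
      "rel (shift x i k) (shift x i g) = rel (shift x i g) x"
      using cyc rel_flip by metis+
    have "d x (shift x i h) = 1"
      using r 2 by (simp add: rel_def)
    moreover have "rel x (shift x i h) \<noteq> rel (shift x i h) x"
      using nsym cyc rel_flip by metis
    ultimately show False
      using no_cyclic_parallelogram_aux[OF x C(2,1,3) _ r] k by (simp add: add.commute)
  qed
qed

text \<open>By \<open>square\<close>, only a cyclic labelling could break the equality. One diagonal
  of the parallelogram is an edge, so the cyclic labels are symmetric, and then opposite sides agree
  as well.\<close>

lemma parallelogram:
  assumes x: "x \<in> V" "i < d1" and C: "g \<in> shrikhande_gens" "h \<in> shrikhande_gens"
    and ne: "h \<noteq> g" "h \<noteq> - g"
  shows "rel (shift x i h) (shift x i (h + g)) = rel x (shift x i g)"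
proof -
  let ?s = "shift x i"
  have V: "x \<in> V" "?s p \<in> V" for p
    using shift_in_V[OF x] x(1) by auto
  note A = adj_shift[OF x] adj_shift_self[OF x]
  have D: "h + g - g = h" "h - (h + g) = - g"
    by simp_all
  have e: "adj x (?s g)" "adj (?s g) (?s (h + g))" "adj (?s (h + g)) (?s h)" "adj (?s h) x"
    by (simp_all only: A D C uminus_gens_iff)
  have "x \<noteq> ?s (h + g)" "?s g \<noteq> ?s h"
    using ne by (auto simp: eq_neg_iff_add_eq_0)
  then consider "rel x (?s g) = rel (?s h) (?s (h + g))"
    | "rel x (?s g) = rel (?s g) (?s (h + g))" "rel (?s g) (?s (h + g)) = rel (?s (h + g)) (?s h)"
      "rel (?s (h + g)) (?s h) = rel (?s h) x"
    using square[OF V(1) V(2) V(2) V(2) _ _ e] by blast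
  then show ?thesis
  proof cases
    case 2
    have "rel x (?s g) = rel (?s g) x"
    proof (cases "g + h \<in> shrikhande_gens")
      case True
      then show ?thesis
        using no_cyclic_parallelogram[OF x C _ _ 2] by (simp add: add.commute)
    next
      case False
      then have k: "g - h \<in> shrikhande_gens"
        using gens_independent[OF C ne] by blast
      have *: "shift (?s h) i (- h) = x" "shift (?s h) i (g - h) = ?s g" "shift (?s h) i g = ?s (h + g)"
        by simp_all
      \<comment> \<open>The edge is now the other diagonal, so the parallelogram is read from its
        corner \<open>?s h\<close> with generators \<open>- h\<close> and \<open>g\<close>.\<close>
      have "rel (?s h) x = rel x (?s h)"
        by (rule no_cyclic_parallelogram[OF V(2)[of h] x(2), of "- h" g "g - h", unfolded *])
          (use k C(1,2) 2 in simp_all)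
      then show ?thesis
        using 2 rel_flip by metis
    qed
    then show ?thesis
      using 2 rel_flip by metis
  qed simp
qed

lemma rel_shift:
  assumes x: "x \<in> V" "i < d1" and C: "g \<in> shrikhande_gens"
  shows "rel (shift x i p) (shift x i (p + g)) = rel x (shift x i g)"
proof (rule gens_generate[OF C, where P = "\<lambda>p. rel (shift x i p) (shift x i (p + g)) = rel x (shift x i g)"])
  fix p h
  assume 3: "rel (shift x i p) (shift x i (p + g)) = rel x (shift x i g)"
    "h \<in> shrikhande_gens" "h \<noteq> g" "h \<noteq> - g"
  have "rel (shift (shift x i p) i h) (shift (shift x i p) i (h + g)) = rel (shift x i p) (shift (shift x i p) i g)"
    by (rule parallelogram) (use shift_in_V[OF x] x C 3 in auto)
  then show "rel (shift x i (p + h)) (shift x i (p + h + g)) = rel x (shift x i g)"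
    using 3 by (simp add: add.assoc)
qed simp

lemma rel_shift_diff:
  assumes x: "x \<in> V" "i < d1" and C: "g \<in> shrikhande_gens" and "q = p + g"
  shows "rel (shift x i p) (shift x i q) = rel x (shift x i g)" "rel (shift x i q) (shift x i p) = rel (shift x i g) x"
proof -
  show "rel (shift x i p) (shift x i q) = rel x (shift x i g)"
    using rel_shift[OF x C, of p] assms(4) by simp
  then show "rel (shift x i q) (shift x i p) = rel (shift x i g) x"
    by (rule rel_flip)
qed

lemma rel_shift_uminus:
  assumes x: "x \<in> V" "i < d1" and C: "g \<in> shrikhande_gens"
  shows "rel x (shift x i (- g)) = rel (shift x i g) x"
  using rel_shift_diff(2)[OF assms, of 0 "- g"] by simp

text \<open>Generators have order four, so the way back from the double step also takes two arcs.\<close>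
lemma rel_shift_double:
  assumes x: "x \<in> V" "i < d1" and C: "g \<in> shrikhande_gens" and d: "d x (shift x i g) = 1"
  shows "rel x (shift x i (g + g)) = (2, 2)"
proof -
  have 1: "d (shift x i p) (shift x i (p + g)) = 1" for p
    using rel_shift[OF x C, of p] d by (simp add: rel_def)
  have "- g + g = (0 :: 4 \<times> 4)" "g + g + g = - g"
    using gens_double(4)[OF C] by (simp_all add: add.assoc)
  then have "d (shift x i (g + g)) (shift x i (- g)) = 1" "d (shift x i (- g)) x = 1"
    using 1[of "g + g"] 1[of "- g"] by simp_all
  moreover have "x \<noteq> shift x i (g + g)" "\<not> adj x (shift x i (g + g))"
    using gens_double[OF C] adj_shift_self(1)[OF x] by auto
  ultimately show ?thesis
    using rel_2_2I[of x "shift x i g" "shift x i (- g)" "shift x i (g + g)"] x shift_in_V[OF x] d 1[of g]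
      by simp
qed

text \<open>A double step has label (2, 2) and repeats the label of its single step. An undirected
  step in one place and a directed one in another would therefore be a configuration excluded by
  \<open>no_mixed_2_2\<close>.\<close>

lemma undirected_shifts:
  assumes x: "x \<in> V" "i < d1" and g: "g \<in> shrikhande_gens" and U: "rel x (shift x i g) = rel (shift x i g) x"
    and y: "y \<in> V" "j < d1" and h: "h \<in> shrikhande_gens"
  shows "rel y (shift y j h) = (1, 1)"
proof -
  have sym: "rel z (shift z k l) = (1, 1)"
    if "rel z (shift z k l) = rel (shift z k l) z" "z \<in> V" "k < d1" "l \<in> shrikhande_gens" for z k l
    using that adj_shift_self(1)[OF that(2,3)] by (metis adj_def rel_def prod.inject)
  have *: "rel y (shift y j l) = rel (shift y j l) y" if l: "d y (shift y j l) = 1" "l \<in> shrikhande_gens" for l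
  proof (rule ccontr)
    assume n: "rel y (shift y j l) \<noteq> rel (shift y j l) y"
    have U': "rel x (shift x i g) = (1, 1)"
      using sym U x g by blast
    then have "d x (shift x i g) = 1"
      by (simp add: rel_def)
    then have 2: "rel x (shift x i (g + g)) = (2, 2)"
      using rel_shift_double x g by blast
    have "rel y (shift y j (l + l)) = (2, 2)"
      using rel_shift_double y l by blast
    moreover have "rel (shift x i g) (shift x i (g + g)) = (1, 1)"
      "rel y (shift y j l) = rel (shift y j l) (shift y j (l + l))"
      using rel_shift[OF x g, of g] U' rel_shift[OF y l(2), of l] by simp_all
    moreover have "adj y (shift y j l)"
      using adj_shift_self(1)[OF y] l by blast
    ultimately show False
      using no_mixed_2_2[OF x(1) shift_in_V[OF x] shift_in_V[OF x] y(1) shift_in_V[OF y] shift_in_V[OF y]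
          U' _ 2 _ _ n] by blast
  qed
  have "adj y (shift y j h)"
    using adj_shift_self(1)[OF y] h by blast
  then consider "d y (shift y j h) = 1" | "d (shift y j h) y = 1"
    by (auto simp: adj_def)
  then have "rel y (shift y j h) = rel (shift y j h) y"
  proof cases
    case 2
    have r: "rel y (shift y j (- h)) = rel (shift y j h) y"
      using rel_shift_uminus[OF y h] .
    then have "d y (shift y j (- h)) = 1"
      using 2 by (simp add: rel_def)
    then have "rel y (shift y j (- h)) = rel (shift y j (- h)) y"
      using * h by simp
    then show ?thesis
      using r rel_flip by metis
  qed (use * h in blast)
  then show ?thesis
    using sym y h by blast
qed

section \<open>Triangles through a generator edge and the labels they force\<close>

lemma shift_common_neighbour:
  assumes x: "x \<in> V" "i < d1"
    and C: "g \<in> shrikhande_gens" "h \<in> shrikhande_gens" "k \<in> shrikhande_gens" "g + h + k = 0"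
    and t: "t \<in> V" "adj x t" "adj t (shift x i g)"
  shows "t = shift x i (- k) \<or> t = shift x i (- h)"
proof -
  let ?s = "shift x i"
  \<comment> \<open>From \<open>?s g\<close> the steps \<open>h\<close> and \<open>k\<close> that
    lead back to \<open>x\<close> can be taken in either order; the intermediate vertices
    \<open>?s (- k)\<close> and \<open>?s (- h)\<close> already exhaust the permitted common
    neighbours.\<close>
  have D: "g - - k = - h" "g - - h = - k"
    using C(4) by (simp_all add: eq_neg_iff_add_eq_0 algebra_simps)
  have "g + h = - k"
    using C(4) by (simp add: eq_neg_iff_add_eq_0)
  then have gh: "g + h \<in> shrikhande_gens"
    using C(3) by simp
  have ne: "x \<noteq> ?s g" "?s (- k) \<noteq> ?s (- h)"
    using gens_triangle[OF C(1,2) gh] \<open>g + h = - k\<close> by simp_all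
  have "adj x (?s (- k))" "adj x (?s (- h))" "adj (?s (- k)) (?s g)" "adj (?s (- h)) (?s g)"
    by (simp_all only: adj_shift[OF x] adj_shift_self[OF x] D uminus_gens_iff C)
  then show ?thesis
    using common_neighbours[OF x(1) shift_in_V[OF x] ne(1) shift_in_V[OF x] shift_in_V[OF x] t(1)]
      t ne by blast
qed

text \<open>The multiples of \<open>g\<close> form a directed 4-cycle, so three arcs lead
  back.\<close>

lemma arc_shift_le_3:
  assumes x: "x \<in> V" "i < d1" and g: "g \<in> shrikhande_gens" and d: "d x (shift x i g) = 1"
  shows "d (shift x i g) x \<le> 3"
proof -
  let ?s = "shift x i"
  have V: "?s p \<in> V" for p
    using shift_in_V[OF x] .
  have "d (?s (- g)) x = 1"
    using rel_shift[OF x g, of "- g"] d by (simp add: rel_def)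
  moreover have "d (?s (g + g)) (?s (- g)) = 1" "d (?s g) (?s (g + g)) = 1"
    using rel_shift[OF x g, of "g + g"] rel_shift[OF x g, of g] d gens_double(4)[OF g]
    by (simp_all add: rel_def add.assoc)
  moreover have "d (?s g) x \<le> d (?s g) (?s (g + g)) + d (?s (g + g)) x"
    "d (?s (g + g)) x \<le> d (?s (g + g)) (?s (- g)) + d (?s (- g)) x"
    using d_triangle V x by blast+
  ultimately show ?thesis
    by linarith
qed

lemma zero_sum_shifts:
  assumes x: "x \<in> V" "i < d1"
    and C: "g \<in> shrikhande_gens" "h \<in> shrikhande_gens" "k \<in> shrikhande_gens" "g + h + k = 0"
  shows "rel (shift x i g) (shift x i (- k)) = rel x (shift x i h)" "rel (shift x i (- k)) x = rel x (shift x i k)"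
    "rel (shift x i g) (shift x i (- h)) = rel x (shift x i k)" "rel (shift x i (- h)) x = rel x (shift x i h)"
proof -
  have D: "- k = g + h" "- h = g + k"
    using C(4) by (simp_all add: minus_equation_iff eq_neg_iff_add_eq_0 algebra_simps neg_eq_iff_add_eq_0)
  show "rel (shift x i g) (shift x i (- k)) = rel x (shift x i h)"
    "rel (shift x i g) (shift x i (- h)) = rel x (shift x i k)"
    using rel_shift_diff(1)[OF x C(2) D(1)] rel_shift_diff(1)[OF x C(3) D(2)] by blast+
  show "rel (shift x i (- k)) x = rel x (shift x i k)" "rel (shift x i (- h)) x = rel x (shift x i h)"
    using rel_shift_uminus[OF x C(3)] rel_shift_uminus[OF x C(2)] rel_flip by blast+
qed

text \<open>A return path of length two runs through one of the two triangles on the edge, and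
  either way it consists of one step in direction \<open>h\<close> and one in direction
  \<open>k\<close>.\<close>

lemma arc_shift_2:
  assumes x: "x \<in> V" "i < d1"
    and C: "g \<in> shrikhande_gens" "h \<in> shrikhande_gens" "k \<in> shrikhande_gens" "g + h + k = 0"
    and d: "d (shift x i g) x = 2"
  shows "d x (shift x i h) = 1 \<and> d x (shift x i k) = 1"
proof -
  obtain t where t: "t \<in> V" "d (shift x i g) t = 1" "d t x = 1"
    using d_midpoint[OF shift_in_V[OF x] x(1) d] by blast
  then have "t = shift x i (- k) \<or> t = shift x i (- h)"
    using shift_common_neighbour[OF x C] by (simp add: adj_def)
  then show ?thesis
    using t zero_sum_shifts[OF x C] by (auto simp: rel_def)
qed

lemma cyclic_triangle_le_2:
  assumes x: "x \<in> V" "i < d1"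
    and C: "g \<in> shrikhande_gens" "h \<in> shrikhande_gens" "k \<in> shrikhande_gens" "g + h + k = 0"
    and d: "d x (shift x i h) = 1" "d x (shift x i k) = 1"
  shows "d (shift x i g) x \<le> 2"
proof -
  have "d (shift x i g) x \<le> d (shift x i g) (shift x i (- k)) + d (shift x i (- k)) x"
    using d_triangle shift_in_V[OF x] x(1) by blast
  then show ?thesis
    using zero_sum_shifts[OF x C] d by (simp add: rel_def)
qed

text \<open>If the directions \<open>g\<close> and \<open>- h\<close> had equal labels, the common
  neighbour \<open>x - k\<close> of the first edge would have a counterpart on the second. Both
  candidates, \<open>x + g\<close> and \<open>x + k\<close>, force \<open>k\<close> and
  \<open>- k\<close> to share a label.\<close>

lemma opposite_labels:
  assumes x: "x \<in> V" "i < d1"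
    and C: "g \<in> shrikhande_gens" "h \<in> shrikhande_gens" "k \<in> shrikhande_gens" "g + h + k = 0"
    and nsym: "rel x (shift x i k) \<noteq> rel (shift x i k) x"
  shows "rel x (shift x i g) \<noteq> rel (shift x i h) x"
proof
  let ?s = "shift x i"
  have V: "?s p \<in> V" for p
    using shift_in_V[OF x] .
  note Z = zero_sum_shifts[OF x C]
  assume eq: "rel x (?s g) = rel (?s h) x"
  then have "rel x (?s g) = rel x (?s (- h))"
    using rel_shift_uminus[OF x C(2)] by simp
  then obtain t where t: "t \<in> V" "rel x t = rel x (?s (- k))" "rel t (?s (- h)) = rel (?s (- k)) (?s g)"
    using transfer[of x "?s g" x "?s (- h)" "?s (- k)"] x V by metis
  have "adj x (?s (- k))" "adj (?s g) (?s (- k))"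
    using Z(1) C adj_rel adj_shift_self(1)[OF x] by (metis uminus_gens_iff)+
  then have "adj x t" "adj t (?s (- h))"
    using t adj_rel adj_sym by metis+
  moreover have "- h + - k + - g = - (g + h + k)"
    by simp
  then have "- h + - k + - g = 0"
    unfolding C(4) by simp
  ultimately have "t = ?s (- (- g)) \<or> t = ?s (- (- k))"
    using shift_common_neighbour[OF x, of "- h" "- k" "- g" t] C(1-3) t(1) by (simp only: uminus_gens_iff)
  then show False
  proof
    assume "t = ?s (- (- k))"
    then show False
      using t(2) nsym rel_flip[OF Z(2)] by simp
  next
    assume "t = ?s (- (- g))"
    then have "rel x (?s g) = rel (?s k) x" "rel (?s g) (?s (- h)) = rel (?s (- k)) (?s g)"
      using t rel_flip[OF Z(2)] by simp_all
    then show False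
      using eq Z(3) rel_flip[OF Z(1)] nsym by simp
  qed
qed

text \<open>In a triangle that is not cyclic, \<open>arc_shift_2\<close> leaves only the labels (1,
  3) and (3, 1), so one generator shares its label with the negative of another, against
  \<open>opposite_labels\<close>. In a cyclic triangle \<open>cyclic_triangle_le_2\<close> bounds
  the way back by two.\<close>

lemma directed_labels:
  assumes x: "x \<in> V" "i < d1"
    and C: "g \<in> shrikhande_gens" "h \<in> shrikhande_gens" "k \<in> shrikhande_gens" "g + h + k = 0"
    and nsym: "\<And>g. g \<in> shrikhande_gens \<Longrightarrow> rel x (shift x i g) \<noteq> rel (shift x i g) x"
  shows "rel x (shift x i g) = (1, 2) \<and> rel x (shift x i h) = (1, 2) \<or>
    rel x (shift x i g) = (2, 1) \<and> rel x (shift x i h) = (2, 1)"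
proof -
  let ?s = "shift x i"
  have N: "- g \<in> shrikhande_gens" "- h \<in> shrikhande_gens" "- k \<in> shrikhande_gens"
    using C by simp_all
  have neg: "d x (?s (- g)) = d (?s g) x" "d (?s (- g)) x = d x (?s g)" if "g \<in> shrikhande_gens" for g
    using rel_shift_uminus[OF x that] by (simp_all add: rel_def)
  have perm: "h + k + g = 0" "k + g + h = 0"
    using C(4) by (simp_all add: algebra_simps)
  have "- g + - h + - k = - (g + h + k)" "- h + - k + - g = - (h + k + g)" "- k + - g + - h = - (k + g + h)"
    by simp_all
  then have nperm: "- g + - h + - k = 0" "- h + - k + - g = 0" "- k + - g + - h = 0"
    unfolding C(4) perm by simp_all
  have label: "d x (?s g) = 1 \<and> (d (?s g) x = 2 \<or> d (?s g) x = 3) \<or>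
      d (?s g) x = 1 \<and> (d x (?s g) = 2 \<or> d x (?s g) = 3)"
    if g: "g \<in> shrikhande_gens" for g
  proof -
    have "?s g \<noteq> x"
      using g zero_notin_gens by auto
    then have "d x (?s g) \<noteq> 0" "d (?s g) x \<noteq> 0"
      using d_eq_0_iff x shift_in_V[OF x] by metis+
    moreover have "d x (?s g) = 1 \<or> d (?s g) x = 1"
      using adj_shift_self(1)[OF x] g adj_def by blast
    moreover have "d x (?s g) \<noteq> d (?s g) x"
      using nsym[OF g] by (auto simp: rel_def)
    moreover have "- g \<in> shrikhande_gens"
      using g by simp
    then have "d x (?s g) = 1 \<Longrightarrow> d (?s g) x \<le> 3" "d (?s g) x = 1 \<Longrightarrow> d x (?s g) \<le> 3"
      using arc_shift_le_3[OF x g] arc_shift_le_3[OF x, of "- g"] neg[OF g] by simp_all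
    ultimately show ?thesis
      by linarith
  qed
  note facts = label[OF C(1)] label[OF C(2)] label[OF C(3)]
    arc_shift_2[OF x C] arc_shift_2[OF x C(2,3,1) perm(1)] arc_shift_2[OF x C(3,1,2) perm(2)]
      arc_shift_2[OF x N nperm(1)] arc_shift_2[OF x N(2,3,1) nperm(2)] arc_shift_2[OF x N(3,1,2) nperm(3)]
      cyclic_triangle_le_2[OF x C] cyclic_triangle_le_2[OF x C(2,3,1) perm(1)] cyclic_triangle_le_2[OF x C(3,1,2) perm(2)]
      cyclic_triangle_le_2[OF x N nperm(1)] cyclic_triangle_le_2[OF x N(2,3,1) nperm(2)] cyclic_triangle_le_2[OF x N(3,1,2) nperm(3)]
      opposite_labels[OF x C nsym[OF C(3)]] opposite_labels[OF x C(2,3,1) perm(1) nsym[OF C(1)]]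
      opposite_labels[OF x C(3,1,2) perm(2) nsym[OF C(2)]]
  show ?thesis
    unfolding rel_def prod.inject
    using facts[unfolded neg[OF C(1)] neg[OF C(2)] neg[OF C(3)] rel_def prod.inject]
    by (elim disjE conjE) (simp_all del: One_nat_def)
qed

end

section \<open>Excluding further coordinates\<close>

context distance_scheme
begin

text \<open>Frees \<open>cyclic_square_diagonal\<close> from the orientation of \<open>x y\<close>
  by walking round the square backwards if necessary, and keeps the directed path beside the
  diagonal as a midpoint for later transfer.\<close>

lemma cyclic_square_edge:
  assumes V: "x \<in> V" "y \<in> V" "z \<in> V" "w \<in> V" and "y \<noteq> w"
    and cyc: "rel x y = rel y z" "rel y z = rel z w" "rel z w = rel w x"
    and adj: "adj x y" "adj x z" and nsym: "rel x y \<noteq> rel y x"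
  shows "rel x z = (1, 1) \<and> (\<exists>r\<in>V. rel x r = (1, 2) \<and> rel r z = (1, 2))"
  using adj(1) unfolding adj_def
proof
  assume d: "d x y = 1"
  show ?thesis
    using cyclic_square_diagonal[OF V \<open>y \<noteq> w\<close> cyc d adj(2) nsym] V(2) cyc(1) by auto
next
  assume d: "d y x = 1"
  have cyc': "rel x w = rel w z" "rel w z = rel z y" "rel z y = rel y x"
    using cyc rel_flip by metis+
  have "d x w = 1"
    using cyc' d by (simp add: rel_def)
  moreover have "rel x w \<noteq> rel w x"
    using cyc' cyc nsym by metis
  ultimately show ?thesis
    using cyclic_square_diagonal[OF V(1,4,3,2) _ cyc' _ adj(2)] \<open>y \<noteq> w\<close> V(4) cyc'(1)
      by auto
qed

text \<open>Two 4-cycles of the clique start with the edge \<open>x y\<close>. Equal opposite sides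
  in both would identify its label with \<open>rel w z\<close> and with \<open>rel z w\<close> and
  make it symmetric, so one of the cycles carries a single label.\<close>

lemma clique_undirected_edge:
  assumes V: "x \<in> V" "y \<in> V" "z \<in> V" "w \<in> V"
    and adj: "adj x y" "adj x z" "adj x w" "adj y z" "adj y w" "adj z w"
    and nsym: "rel x y \<noteq> rel y x"
  obtains q r where "q \<in> {z, w}" "r \<in> V" "rel x q = (1, 1)" "rel x r = (1, 2)" "rel r q = (1, 2)"
proof -
  note adj' = adj adj[THEN adj_sym]
  have ne: "x \<noteq> z" "x \<noteq> w" "y \<noteq> z" "y \<noteq> w"
    using adj V not_adj_same by metis+
  have "\<not> (rel x y = rel w z \<and> rel x y = rel z w)"
    using nsym rel_flip by metis
  then consider "rel x y = rel y z" "rel y z = rel z w" "rel z w = rel w x"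
    | "rel x y = rel y w" "rel y w = rel w z" "rel w z = rel z x"
    using square[OF V ne(1,4)] square[OF V(1,2,4,3) ne(2,3)] adj' by blast
  then show ?thesis
  proof cases
    case 1
    then show ?thesis
      using cyclic_square_edge[OF V ne(4) 1 adj(1,2) nsym] that[of z] by blast
  next
    case 2
    then show ?thesis
      using cyclic_square_edge[OF V(1,2,4,3) ne(3) 2 adj(1,3) nsym] that[of w] by blast
  qed
qed

text \<open>Each of the two common neighbours is reached along an arc and left against one, or
  conversely, so no directed path of length two exists in either direction. Following one arc and
  then going back along the other takes three steps.\<close>

lemma rel_3_3I:
  assumes V: "x \<in> V" "y \<in> V" "z \<in> V" "w \<in> V" and ne: "x \<noteq> z" "\<not> adj x z"
    and r: "rel x y = (1, 2)" "rel y z = (2, 1)" "rel x w = (2, 1)" "rel w z = (1, 2)"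
  shows "rel x z = (3, 3)"
proof -
  have d: "d x y = 1" "d y x = 2" "d y z = 2" "d z y = 1" "d x w = 2" "d w x = 1" "d w z = 1" "d z w = 2"
    using r by (simp_all add: rel_def)
  have yw: "y \<noteq> w"
    using d by auto
  have "t = y \<or> t = w" if "t \<in> V" "adj x t" "adj t z" for t
    using common_neighbours[OF V(1,3) ne(1) V(2,4) that(1)] that yw d by (auto simp: adj_def)
  then have "d x t = 1 \<Longrightarrow> d t z \<noteq> 1" "d z t = 1 \<Longrightarrow> d t x \<noteq> 1"
    if "t \<in> V" for t
    using that d unfolding adj_def by fastforce+
  then have "d x z \<noteq> 2" "d z x \<noteq> 2"
    using d_midpoint V by blast+
  moreover have "d x z \<noteq> 0" "d z x \<noteq> 0" "d x z \<noteq> 1" "d z x \<noteq> 1"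
    using V ne d_eq_0_iff by (auto simp: adj_def)
  moreover have "d x z \<le> 3" "d z x \<le> 3"
    using d_triangle[of x y z] d_triangle[of z y x] V d by auto
  ultimately show ?thesis
    by (simp add: rel_def)
qed

end

section \<open>Directed and undirected edges in clique coordinates\<close>

context doob_scheme
begin

lemma adjE:
  assumes "x \<in> V" "y \<in> V" "adj x y"
  obtains j where "y = x(j := y j)" "fibre_adj d1 j (x j) (y j)" "j < d1 + d2"
proof -
  obtain j where j: "fibre_adj d1 j (x j) (y j)" "\<And>i. i \<noteq> j \<Longrightarrow> x i = y i"
    using assms adj_iff_doob_adj unfolding doob_adj_def by blast
  have "x j \<in> fibre d1 d2 j" "y j \<in> fibre d1 d2 j" "x j \<noteq> y j"
    using assms j by (auto simp: doob_verts_def fibre_adj_def)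
  then have "j < d1 + d2"
    by (auto simp: fibre_def split: if_splits)
  moreover have "y = x(j := y j)"
    using j(2) by (auto simp: fun_eq_iff)
  ultimately show ?thesis
    using that j(1) by blast
qed

lemma clique_vertex:
  assumes "x \<in> V" "d1 \<le> j" "j < d1 + d2"
  shows "x(j := (v, 0)) \<in> V" "x j = (fst (x j), 0)"
    "v \<noteq> w \<Longrightarrow> adj (x(j := (v, 0))) (x(j := (w, 0)))"
proof -
  have *: "y(j := (v, 0)) \<in> V" if "y \<in> V" for y v
  proof -
    have "(y(j := (v, 0))) i \<in> fibre d1 d2 i" for i
      using that assms(2,3) by (cases "i = j") (simp_all add: doob_verts_def fibre_def)
    then show ?thesis
      by (simp add: doob_verts_def)
  qed
  show "x(j := (v, 0)) \<in> V"
    using * assms(1) .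
  have "x j \<in> fibre d1 d2 j"
    using assms(1) by (simp add: doob_verts_def)
  then show "x j = (fst (x j), 0)"
    using assms(2,3) by (auto simp: fibre_def)
  assume "v \<noteq> w"
  then have "doob_adj d1 (x(j := (v, 0))) (x(j := (w, 0)))"
    using assms(2) unfolding doob_adj_def fibre_adj_def by (intro exI[of _ j]) auto
  then show "adj (x(j := (v, 0))) (x(j := (w, 0)))"
    using adj_iff_doob_adj * assms(1) by blast
qed

lemma clique_directed_edge:
  assumes x: "x \<in> V" and j: "d1 \<le> j" "j < d1 + d2" and y: "y \<in> V" "y = x(j := y j)"
    and nsym: "rel x y \<noteq> rel y x"
  obtains q r where "q \<in> V" "q = x(j := q j)" "r \<in> V" "rel x q = (1, 1)" "rel x r = (1, 2)" "rel r q = (1, 2)"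
proof -
  obtain a b where ab: "x j = (a, 0)" "y j = (b, 0)"
    using clique_vertex(2)[OF x j] clique_vertex(2)[OF y(1) j] by blast
  have "x \<noteq> y"
    using nsym by auto
  then have "a \<noteq> b"
    using ab y(2) by (metis fun_upd_triv)
  \<comment> \<open>The two remaining values complete \<open>x\<close> and \<open>y\<close> to the
    4-clique needed for \<open>clique_undirected_edge\<close>.\<close>
  then have "card (UNIV - {a, b}) = 2"
    by (simp add: card_Diff_subset)
  then obtain c e where ce: "UNIV - {a, b} = {c, e}" "c \<noteq> e"
    by (auto simp: card_2_iff)
  then have ne: "c \<noteq> a" "c \<noteq> b" "e \<noteq> a" "e \<noteq> b"
    by auto
  let ?x = "\<lambda>v. x(j := (v, 0))"
  have xy: "x = ?x a" "y = ?x b"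
    using ab y(2) by (metis fun_upd_triv)+
  note A = clique_vertex(3)[OF x j]
  have adj: "adj x y" "adj x (?x c)" "adj x (?x e)" "adj y (?x c)" "adj y (?x e)" "adj (?x c) (?x e)"
    using A[OF \<open>a \<noteq> b\<close>, folded xy] A[OF ne(1)[symmetric], folded xy] A[OF ne(3)[symmetric], folded xy]
      A[OF ne(2)[symmetric], folded xy] A[OF ne(4)[symmetric], folded xy] A[OF ce(2)] by blast+
  show ?thesis
  proof (rule clique_undirected_edge[OF x y(1) clique_vertex(1)[OF x j] clique_vertex(1)[OF x j] adj nsym])
    fix q r
    assume "q \<in> {?x c, ?x e}" "r \<in> V" "rel x q = (1, 1)" "rel x r = (1, 2)" "rel r q = (1, 2)"
    then show ?thesis
      using that[of q r] clique_vertex(1)[OF x j] by auto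
  qed
qed

text \<open>Any other vertex of the clique, here the one at \<open>a + 1\<close>, will do: either
  its edge to \<open>x\<close> is undirected, or being directed it forces an undirected edge at
  \<open>x\<close> elsewhere in the clique.\<close>

lemma undirected_clique_edge:
  assumes x: "x \<in> V" and j: "d1 \<le> j" "j < d1 + d2"
  obtains q where "q \<in> V" "q = x(j := q j)" "rel x q = (1, 1)"
proof -
  obtain a where a: "x j = (a, 0)"
    using clique_vertex(2)[OF x j] by blast
  let ?y = "x(j := (a + 1, 0))"
  have y: "?y \<in> V" "adj x ?y" "?y = x(j := ?y j)"
    using clique_vertex(1)[OF x j] clique_vertex(3)[OF x j, of a "a + 1"] a by (simp_all add: fun_upd_idem)
  show ?thesis
  proof (cases "rel x ?y = rel ?y x")
    case True
    then have "rel x ?y = (1, 1)"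
      using y(2) by (metis adj_def rel_def prod.inject)
    then show ?thesis
      using that y by blast
  next
    case False
    then show ?thesis
      using clique_directed_edge[OF x j y(1,3) False] that by metis
  qed
qed

text \<open>If one Shrikhande step were undirected, all would be, and the given directed edge would
  lie in a clique. There it puts a directed two-step path beside an undirected edge, but the copy of
  that path beside a Shrikhande edge would consist of undirected steps.\<close>

lemma shifts_directed:
  assumes "0 < d1" and e: "p \<in> V" "q \<in> V" "adj p q" "rel p q \<noteq> rel q p"
    and x: "x \<in> V" "i < d1" and g: "g \<in> shrikhande_gens"
  shows "rel x (shift x i g) \<noteq> rel (shift x i g) x"
proof
  assume "rel x (shift x i g) = rel (shift x i g) x"
  then have U: "rel y (shift y j h) = (1, 1)" if "y \<in> V" "j < d1" "h \<in> shrikhande_gens" for y j h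
    using undirected_shifts[OF x g] that by blast
  obtain j where j: "q = p(j := q j)" "fibre_adj d1 j (p j) (q j)" "j < d1 + d2"
    using adjE e by blast
  have "d1 \<le> j"
  proof (rule ccontr)
    assume "\<not> d1 \<le> j"
    then have "q = shift p j (q j - p j)" "q j - p j \<in> shrikhande_gens" "j < d1"
      using j by (simp_all add: shift_def fibre_adj_def)
    then have "rel p q = (1, 1)"
      using U[OF e(1)] by metis
    then show False
      using e(4) rel_flip by (auto simp: rel_def)
  qed
  then obtain u v where uv: "u \<in> V" "v \<in> V" "rel p u = (1, 1)" "rel p v = (1, 2)" "rel v u = (1, 2)"
    using clique_directed_edge[OF e(1) _ j(3) e(2) j(1) e(4)] by blast
  have "rel p u = rel x (shift x i g)"
    using uv U[OF x g] by simp
  then obtain t where t: "t \<in> V" "rel x t = (1, 2)" "rel t (shift x i g) = (1, 2)"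
    using transfer[of p u x "shift x i g" v] e uv x shift_in_V by metis
  obtain h k where hk: "h \<in> shrikhande_gens" "k \<in> shrikhande_gens" "g + h + k = 0"
    using gens_zero_sum[OF g] by blast
  have "adj x t" "adj t (shift x i g)"
    using t by (simp_all add: adj_iff_rel)
  then have "t = shift x i (- k) \<or> t = shift x i (- h)"
    using shift_common_neighbour[OF x g hk t(1)] by blast
  then have "rel x t = (1, 1)"
    using U[OF x] hk uminus_gens_iff by metis
  then show False
    using t by simp
qed

end

lemma zero_in_doob_verts: "(\<lambda>_. 0) \<in> doob_verts d1 d2"
  by (simp add: doob_verts_def fibre_def mem_Times_iff)

section \<open>Schemes in which every Shrikhande step is directed\<close>

locale directed_doob_scheme = doob_scheme +
  assumes d1_pos: "0 < d1"
    and directed: "\<lbrakk>x \<in> doob_verts d1 d2; i < d1; g \<in> shrikhande_gens\<rbrakk> \<Longrightarrow> rel x (shift x i g) \<noteq> rel (shift x i g) x"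
begin

lemma shift_label:
  assumes x: "x \<in> V" "i < d1" and g: "g \<in> shrikhande_gens"
  shows "rel x (shift x i g) = (1, 2) \<or> rel x (shift x i g) = (2, 1)"
proof -
  obtain h k where hk: "h \<in> shrikhande_gens" "k \<in> shrikhande_gens" "g + h + k = 0"
    using gens_zero_sum[OF g] by blast
  then show ?thesis
    using directed_labels[OF x g hk] directed[OF x] by blast
qed

lemma zero_sum_same_label:
  assumes x: "x \<in> V" "i < d1"
    and C: "g \<in> shrikhande_gens" "h \<in> shrikhande_gens" "k \<in> shrikhande_gens" "g + h + k = 0"
  shows "rel x (shift x i h) = rel x (shift x i g)" "rel x (shift x i k) = rel x (shift x i g)"
proof -
  have "g + k + h = 0"
    using C(4) by (simp add: algebra_simps)
  then show "rel x (shift x i h) = rel x (shift x i g)" "rel x (shift x i k) = rel x (shift x i g)"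
    using directed_labels[OF x C] directed_labels[OF x C(1,3,2)] directed[OF x] by metis+
qed

lemma cyclic_triangle:
  assumes x: "x \<in> V" "i < d1"
  obtains g h k where "g \<in> shrikhande_gens" "h \<in> shrikhande_gens" "k \<in> shrikhande_gens" "g + h + k = 0"
    "rel x (shift x i g) = (1, 2)" "rel x (shift x i h) = (1, 2)" "rel x (shift x i k) = (1, 2)"
proof -
  have one: "(1, 0) \<in> shrikhande_gens"
    by (simp add: shrikhande_gens_def)
  obtain g where g: "g \<in> shrikhande_gens" "rel x (shift x i g) = (1, 2)"
  proof (cases "rel x (shift x i (1, 0)) = (1, 2)")
    case False
    then have "rel x (shift x i (1, 0)) = (2, 1)"
      using shift_label[OF x one] by blast
    then have "rel (shift x i (1, 0)) x = (1, 2)"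
      by (simp add: rel_def)
    then show ?thesis
      using that[of "- (1, 0)"] one rel_shift_uminus[OF x one] by (simp only: uminus_gens_iff)
  qed (use one that in blast)
  obtain h k where hk: "h \<in> shrikhande_gens" "k \<in> shrikhande_gens" "g + h + k = 0"
    using gens_zero_sum[OF g(1)] by blast
  then show ?thesis
    using that[OF g(1) hk g(2)] zero_sum_same_label[OF x g(1) hk] g(2) by simp
qed

text \<open>The square through \<open>x\<close>, \<open>x + g\<close>, \<open>x + g - h\<close> and
  \<open>x - h\<close> has the mixed orientation required by \<open>rel_3_3I\<close>. The other two
  claims record the midpoints \<open>x + g\<close> and \<open>x + (g + g)\<close> of this pair, the
  latter because \<open>g + g + k = g - h\<close>; they are what a further clique or Shrikhande
  coordinate cannot reproduce.\<close>

lemma rel_shift_difference: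
  assumes x: "x \<in> V" "i < d1"
    and C: "g \<in> shrikhande_gens" "h \<in> shrikhande_gens" "k \<in> shrikhande_gens" "g + h + k = 0"
    and r: "rel x (shift x i g) = (1, 2)"
  shows "rel x (shift x i (g - h)) = (3, 3)"
    "rel (shift x i g) (shift x i (g - h)) = (2, 1)"
    "rel (shift x i (g + g)) (shift x i (g - h)) = (1, 2)"
proof -
  have rh: "rel x (shift x i h) = (1, 2)" "rel x (shift x i k) = (1, 2)"
    using zero_sum_same_label[OF x C] r by simp_all
  then have rh': "rel (shift x i h) x = (2, 1)"
    by (simp add: rel_def)
  have "g = (g - h) + h" "g - h = - h + g" "g - h = (g + g) + k"
    using C(4) by (simp_all add: eq_neg_iff_add_eq_0 diff_eq_eq algebra_simps)
  then show 1: "rel (shift x i g) (shift x i (g - h)) = (2, 1)"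
    and 2: "rel (shift x i (g + g)) (shift x i (g - h)) = (1, 2)"
    using rel_shift_diff(2)[OF x C(2), of g "g - h"] rel_shift_diff(1)[OF x C(3), of "g - h" "g + g"] rh rh'
      by metis+
  have 3: "rel (shift x i (- h)) (shift x i (g - h)) = (1, 2)"
    using rel_shift_diff(1)[OF x C(1), of "g - h" "- h"] r by simp
  have 4: "rel x (shift x i (- h)) = (2, 1)"
    using rel_shift_uminus[OF x C(2)] rh' by simp
  have "g + h = - k"
    using C(4) by (simp add: eq_neg_iff_add_eq_0)
  then have "g + h \<in> shrikhande_gens"
    using C(3) by simp
  from gens_triangle[OF C(1,2) this] have "g \<noteq> h" "g - h \<notin> shrikhande_gens"
    using uminus_gens_iff[of "g - h"] by (simp_all only: minus_diff_eq not_False_eq_True)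
  then have "x \<noteq> shift x i (g - h)" "\<not> adj x (shift x i (g - h))"
    using adj_shift_self(1)[OF x] by simp_all
  then show "rel x (shift x i (g - h)) = (3, 3)"
    using rel_3_3I[OF x(1) shift_in_V[OF x] shift_in_V[OF x] shift_in_V[OF x] _ _ r 1 4 3] by blast
qed

text \<open>A double step in one coordinate combined with an undirected clique edge in another gives
  a pair with label (3, 3). It has no common neighbour, because the double step is not an edge of
  its fibre.\<close>

lemma d2_eq_0: "d2 = 0"
proof (rule ccontr)
  assume "d2 \<noteq> 0"
  then have j: "d1 \<le> d1" "d1 < d1 + d2"
    by simp_all
  have z: "(\<lambda>_. 0) \<in> V"
    by (rule zero_in_doob_verts)
  let ?z = "\<lambda>_. 0 :: 4 \<times> 4"
  obtain w where w: "w \<in> V" "w = ?z(d1 := w d1)" "rel ?z w = (1, 1)"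
    using undirected_clique_edge[OF z j] by blast
  obtain g h k where C: "g \<in> shrikhande_gens" "h \<in> shrikhande_gens" "k \<in> shrikhande_gens" "g + h + k = 0"
      and r: "rel ?z (shift ?z 0 g) = (1, 2)"
    using cyclic_triangle[OF z d1_pos] by metis
  let ?y = "shift ?z 0 (g + g)"
  have y: "?y \<in> V"
    using shift_in_V[OF z d1_pos] .
  have "d ?z (shift ?z 0 g) = 1"
    using r by (simp add: rel_def)
  then have "rel ?z ?y = (2, 2)"
    using rel_shift_double[OF z d1_pos C(1)] by blast
  moreover have "d ?y w \<le> d ?y ?z + d ?z w" "d w ?y \<le> d w ?z + d ?z ?y"
    using d_triangle w(1) y z by blast+
  ultimately have le: "d ?y w \<le> 3" "d w ?y \<le> 3"
    using w(3) by (simp_all add: rel_def)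
  have "w d1 \<noteq> 0"
  proof
    assume "w d1 = 0"
    then have "w = ?z"
      using w(2) by (metis fun_upd_triv)
    then show False
      using w(3) rel_same[OF z] by simp
  qed
  moreover have "?y d1 = 0" "w 0 = 0" "?y 0 = g + g" "g + g \<noteq> 0" "g + g \<notin> shrikhande_gens"
    using d1_pos w(2) gens_double[OF C(1)] by (simp_all, metis fun_upd_other less_numeral_extra(3))
  ultimately have ne: "?y 0 \<noteq> w 0" "?y d1 \<noteq> w d1" "0 \<noteq> d1" "\<not> fibre_adj d1 0 (?y 0) (w 0)"
    using d1_pos uminus_gens_iff[of "g + g"] unfolding fibre_adj_def by (simp_all del: uminus_gens_iff)
  have nadj: "\<not> adj ?y w"
    using doob_adj_diff ne adj_iff_doob_adj[OF y w(1)] by blast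
  have ncommon: "\<not> (adj ?y t \<and> adj t w)" if "t \<in> V" for t
    using no_common_neighbour[OF ne, of t] adj_iff_doob_adj y w(1) that by blast
  have "d ?y w \<noteq> 0" "d w ?y \<noteq> 0"
    using d_eq_0_iff y w(1) ne(1) by metis+
  moreover have "d ?y w \<noteq> 1" "d w ?y \<noteq> 1"
    using nadj by (auto simp: adj_def)
  moreover have "d ?y w \<noteq> 2" "d w ?y \<noteq> 2"
    using ncommon d_midpoint[OF y w(1)] d_midpoint[OF w(1) y] unfolding adj_def by blast+
  ultimately have "d ?y w = 3" "d w ?y = 3"
    using le by linarith+
  then have "rel ?z (shift ?z 0 (g - h)) = rel ?y w"
    using rel_shift_difference(1)[OF z d1_pos C r] by (simp add: rel_def)
  \<comment> \<open>The counterpart of the common neighbour \<open>shift ?z 0 g\<close> inside the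
    Shrikhande coordinate.\<close>
  then obtain t where t: "t \<in> V" "rel ?y t = (1, 2)" "rel t w = (2, 1)"
    using transfer[of ?z "shift ?z 0 (g - h)" ?y w "shift ?z 0 g"] z y w(1) shift_in_V[OF z d1_pos] r
      rel_shift_difference(2)[OF z d1_pos C r] by metis
  then show False
    using ncommon[OF t(1)] by (simp add: adj_iff_rel)
qed

text \<open>If both steps have the same label, a cyclic square would make that label symmetric, so
  opposite sides agree. Otherwise \<open>- h\<close> has the label of \<open>g\<close>, since only
  two labels occur, and reversing edges gives the claim for \<open>h\<close>.\<close>

lemma rel_shift_across:
  assumes x: "x \<in> V" and ij: "i < d1" "j < d1" "i \<noteq> j"
    and g: "g \<in> shrikhande_gens" and h: "h \<in> shrikhande_gens"
  shows "rel (shift x i g) (shift (shift x i g) j h) = rel x (shift x j h)"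
proof -
  have same: "rel (shift x i g) (shift (shift x i g) j h) = rel x (shift x j h)"
    if eq: "rel x (shift x i g) = rel x (shift x j h)" and h: "h \<in> shrikhande_gens" for h
  proof -
    let ?y = "shift x i g" and ?w = "shift x j h" and ?z = "shift (shift x i g) j h"
    have z: "?z = shift ?w i g"
      using shift_swap[OF ij(3)] by blast
    have V: "?y \<in> V" "?w \<in> V" "?z \<in> V"
      using shift_in_V x ij by simp_all
    have "g \<noteq> 0" "h \<noteq> 0"
      using g h zero_notin_gens by auto
    then have "x i \<noteq> ?z i" "?y i \<noteq> ?w i"
      using ij by simp_all
    then have ne: "x \<noteq> ?z" "?y \<noteq> ?w"
      by metis+
    have adj: "adj x ?y" "adj ?y ?z" "adj ?w ?z" "adj x ?w"
      using adj_shift_self(1) x ij V g h z by metis+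
    have "rel x ?y \<noteq> rel ?w x"
      using eq directed[OF x ij(2) h] by simp
    then show ?thesis
      using square[OF x V(1,3,2) ne adj(1,2) adj_sym[OF adj(3)] adj_sym[OF adj(4)]] by metis
  qed
  show ?thesis
  proof (cases "rel x (shift x i g) = rel x (shift x j h)")
    case False
    have "rel x (shift x j (- h)) = rel (shift x j h) x"
      using rel_shift_uminus[OF x ij(2) h] .
    then have "rel x (shift x i g) = rel x (shift x j (- h))"
      using False shift_label[OF x ij(1) g] shift_label[OF x ij(2) h] by (auto simp: rel_def)
    then have "rel (shift x i g) (shift (shift x i g) j (- h)) = rel x (shift x j (- h))"
      using same h by simp
    then show ?thesis
      using rel_shift_uminus[OF x ij(2) h] rel_shift_uminus[OF shift_in_V[OF x ij(1)] ij(2) h] rel_flip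
        by metis
  qed (use same h in blast)
qed

lemma adj_shift_obtain:
  assumes "x \<in> V" "y \<in> V" "adj x y"
  obtains j g where "j < d1" "g \<in> shrikhande_gens" "y = shift x j g"
proof -
  obtain j where j: "y = x(j := y j)" "fibre_adj d1 j (x j) (y j)" "j < d1 + d2"
    using adjE assms by blast
  then show ?thesis
    using that[of j "y j - x j"] by (simp add: d2_eq_0 fibre_adj_def shift_def)
qed

text \<open>A pair at distance two in both directions lies on a directed 4-cycle, and a directed 4-cycle
  cannot use two coordinates.\<close>
lemma rel_2_2_shift:
  assumes x: "x \<in> V" "i < d1" and g: "g \<in> shrikhande_gens" "rel x (shift x i g) = (1, 2)"
    and t: "t \<in> V" "rel x t = (2, 2)"
  obtains j q where "j < d1" "t = shift x j q"
proof -
  have V: "shift x i p \<in> V" for p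
    using shift_in_V[OF x] .
  have "d x (shift x i g) = 1"
    using g(2) by (simp add: rel_def)
  then have gg: "rel x (shift x i (g + g)) = rel x t"
    using rel_shift_double[OF x g(1)] t(2) by simp
  \<comment> \<open>The 4-cycle of multiples of \<open>g\<close> offers a forward midpoint
    \<open>x + g\<close> and a backward midpoint \<open>x - g\<close> of the double step; both are
    transferred to the pair \<open>x t\<close>.\<close>
  have "- g = (g + g) + g"
    using gens_double(4)[OF g(1)] by (simp add: add.assoc)
  then have "rel (shift x i (- g)) (shift x i (g + g)) = rel (shift x i g) x"
    using rel_shift_diff(2)[OF x g(1)] by blast
  moreover have "rel x (shift x i (- g)) = rel (shift x i g) x"
    using rel_shift_uminus[OF x g(1)] .
  moreover have "rel (shift x i g) x = (2, 1)"
    using g(2) by (simp add: rel_def)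
  ultimately obtain s' where s': "s' \<in> V" "rel x s' = (2, 1)" "rel s' t = (2, 1)"
    using transfer[OF gg x(1) V x(1) t(1) V[of "- g"]] by metis
  have "rel (shift x i g) (shift x i (g + g)) = (1, 2)"
    using rel_shift[OF x g(1)] g(2) by simp
  then obtain s where s: "s \<in> V" "rel x s = (1, 2)" "rel s t = (1, 2)"
    using transfer[OF gg x(1) V x(1) t(1) V[of g]] g(2) by metis
  have adj: "adj x s" "adj s t" "adj x s'" "adj s' t"
    using s s' by (simp_all add: adj_iff_rel)
  obtain a p where a: "a < d1" "p \<in> shrikhande_gens" "s = shift x a p"
    using adj_shift_obtain[OF x(1) s(1) adj(1)] by blast
  obtain b q where b: "b < d1" "q \<in> shrikhande_gens" "t = shift s b q"
    using adj_shift_obtain[OF s(1) t(1) adj(2)] by blast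
  have "a = b"
  proof (rule ccontr)
    assume ne: "a \<noteq> b"
    \<comment> \<open>With two coordinates, \<open>s\<close> and \<open>?r\<close> would be all the
      common neighbours of \<open>x\<close> and \<open>t\<close>. Both are reached from
      \<open>x\<close> with label (1, 2), which leaves no place for \<open>s'\<close>.\<close>
    let ?r = "shift x b q"
    have r: "?r \<in> V" "t = shift ?r a p"
      using shift_in_V[OF x(1) b(1)] shift_swap[OF ne] a b by simp_all
    have xr: "rel x ?r = (1, 2)"
      using rel_shift_across[OF x(1) a(1) b(1) ne a(2) b(2)] a(3) b(3) s(3) by simp
    then have "adj x ?r"
      by (simp add: adj_iff_rel)
    moreover have "adj ?r t"
      using adj_shift_self(1)[OF r(1) a(1)] r(2) a(2) by simp
    moreover have "p \<noteq> 0"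
      using a(2) zero_notin_gens by auto
    then have "?r a \<noteq> s a"
      using ne a(3) by simp
    then have "s \<noteq> ?r"
      by auto
    moreover have "x \<noteq> t"
      using t rel_same[OF x(1)] by auto
    moreover have "s' \<noteq> s" "s' \<noteq> ?r"
      using s s' xr by auto
    ultimately show False
      using common_neighbours[OF x(1) t(1) _ s(1) r(1) s'(1)] adj by blast
  qed
  then show ?thesis
    using that[of b "p + q"] a b by simp
qed

text \<open>A step along an arc in one coordinate and a step against an arc in another give a pair
  \<open>x ?w\<close> with label (3, 3). The counterpart \<open>t\<close> of
  \<open>x + (g + g)\<close> differs from \<open>x\<close> in one coordinate only and by a
  non-generator, hence from its supposed neighbour \<open>?w\<close> in two coordinates.\<close>

lemma d1_eq_1: "d1 = 1"
proof (rule ccontr)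
  assume "d1 \<noteq> 1"
  then have d1: "1 < d1" and ij: "(0 :: nat) \<noteq> 1"
    using d1_pos by simp_all
  obtain x where x: "x \<in> V"
    using zero_in_doob_verts by blast
  obtain g h k where C: "g \<in> shrikhande_gens" "h \<in> shrikhande_gens" "k \<in> shrikhande_gens" "g + h + k = 0"
      and r: "rel x (shift x 0 g) = (1, 2)"
    using cyclic_triangle[OF x d1_pos] by metis
  obtain e where e: "e \<in> shrikhande_gens" "rel x (shift x 1 e) = (1, 2)"
    using cyclic_triangle[OF x d1] by metis
  have V: "shift x 0 p \<in> V" for p
    using shift_in_V[OF x d1_pos] .
  have ne: "- e \<in> shrikhande_gens"
    using e(1) by simp
  let ?w = "shift (shift x 0 g) 1 (- e)" and ?u = "shift x 1 (- e)"
  have w: "?w \<in> V" "?u \<in> V" "?w = shift ?u 0 g"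
    using shift_in_V d1 d1_pos x shift_swap[OF ij] by simp_all
  have u: "rel x ?u = (2, 1)"
    using rel_shift_uminus[OF x d1 e(1)] e(2) by (simp add: rel_def)
  have gw: "rel (shift x 0 g) ?w = (2, 1)"
    using rel_shift_across[OF x d1_pos d1 ij C(1) ne] u by simp
  have uw: "rel ?u ?w = (1, 2)"
    using rel_shift_across[OF x d1 d1_pos ij[symmetric] ne C(1)] r w(3) by simp
  have "g \<noteq> 0" "e \<noteq> 0"
    using C(1) e(1) zero_notin_gens by auto
  then have diff: "x 0 \<noteq> ?w 0" "x 1 \<noteq> ?w 1"
    by simp_all
  then have "x \<noteq> ?w" "\<not> adj x ?w"
    using doob_adj_diff[of d1 x ?w 0 1] adj_iff_doob_adj[OF x w(1)] ij by metis+
  then have "rel x ?w = (3, 3)"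
    using rel_3_3I[OF x V w(1,2) _ _ r gw u uw] by blast
  then have "rel x (shift x 0 (g - h)) = rel x ?w"
    using rel_shift_difference(1)[OF x d1_pos C r] by simp
  moreover have "d x (shift x 0 g) = 1"
    using r by (simp add: rel_def)
  then have "rel x (shift x 0 (g + g)) = (2, 2)"
    using rel_shift_double[OF x d1_pos C(1)] by blast
  ultimately obtain t where t: "t \<in> V" "rel x t = (2, 2)" "rel t ?w = (1, 2)"
    using transfer[OF _ x V x w(1) V[of "g + g"]] rel_shift_difference(3)[OF x d1_pos C r] by metis
  obtain j q where j: "j < d1" "t = shift x j q"
    using rel_2_2_shift[OF x d1_pos C(1) r t(1,2)] by blast
  have "\<not> adj x t"
    using t(2) by (simp add: adj_iff_rel)
  then have q: "q \<notin> shrikhande_gens"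
    using adj_shift_self(1)[OF x j(1)] j(2) by simp
  have "adj t ?w"
    using t(3) by (simp add: adj_iff_rel)
  then have "\<not> (t 0 \<noteq> ?w 0 \<and> t 1 \<noteq> ?w 1)"
    using doob_adj_diff[of d1 t ?w 0 1] adj_iff_doob_adj[OF t(1) w(1)] ij by blast
  moreover have "t 0 \<noteq> ?w 0"
    using diff(1) j(2) q C(1) by (cases "j = 0") auto
  moreover have "t 1 \<noteq> ?w 1"
  proof (cases "j = 1")
    case True
    then show ?thesis
      using j(2) q ne by (auto simp del: uminus_gens_iff)
  next
    case False
    then show ?thesis
      using diff(2) j(2) by simp
  qed
  ultimately show False
    by blast
qed

section \<open>Recovering the Cayley digraph from the single remaining coordinate\<close>

lemma shift_parametrization:
  "bij_betw (shift (\<lambda>_. 0) 0) UNIV V"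
proof (rule bij_betw_imageI)
  have "x = shift (\<lambda>_. 0) 0 (x 0)" if "x \<in> V" for x
  proof
    fix i
    have "x i \<in> fibre d1 d2 i"
      using that by (simp add: doob_verts_def)
    then show "x i = shift (\<lambda>_. 0) 0 (x 0) i"
      using d1_eq_1 d2_eq_0 by (cases "i = 0") (simp_all add: fibre_def)
  qed
  then show "range (shift (\<lambda>_. 0) 0) = V"
    using shift_in_V[OF zero_in_doob_verts d1_pos] by blast
qed (simp add: inj_on_def)

text \<open>The label of \<open>(1, 0)\<close> decides all others: its zero-sum triple shares it,
  and the negatives carry the reversed label. If the triple points backwards, composing the
  parametrization with negation turns it round.\<close>

lemma cayley_parametrization:
  obtains f :: "4 \<times> 4 \<Rightarrow> nat \<Rightarrow> 4 \<times> 4" where "bij_betw f UNIV V"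
    "\<And>p q. d (f p) (f q) = 1 \<longleftrightarrow> q - p \<in> {(1, 0), (0, 1), (-1, -1)}"
proof -
  let ?s = "shift (\<lambda>_. 0 :: 4 \<times> 4) 0" and ?z = "\<lambda>_. 0 :: 4 \<times> 4"
  let ?C = "{(1, 0), (0, 1), (-1, -1)} :: (4 \<times> 4) set"
  have z: "?z \<in> V" "0 < d1"
    using zero_in_doob_verts d1_pos by blast+
  have C: "(1, 0) \<in> shrikhande_gens" "(0, 1) \<in> shrikhande_gens" "(-1, -1) \<in> shrikhande_gens"
    "(1, 0) + (0, 1) + (-1, -1) = (0 :: 4 \<times> 4)"
    by (simp_all add: shrikhande_gens_def zero_prod_def)
  have gens: "g \<in> ?C \<or> - g \<in> ?C" if "g \<in> shrikhande_gens" for g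
    using that by (auto simp: shrikhande_gens_def)
  have disj: "- g \<notin> ?C" if "g \<in> ?C" for g
    using that by auto
  have Cg: "g \<in> shrikhande_gens" if "g \<in> ?C" for g
    using that C by auto
  have same: "rel ?z (?s g) = rel ?z (?s (1, 0))" if "g \<in> ?C" for g
    using that zero_sum_same_label[OF z C] by auto
  have neg: "rel ?z (?s (- g)) = rel (?s (1, 0)) ?z" if "g \<in> ?C" for g
    using rel_shift_uminus[OF z Cg[OF that]] rel_flip[OF same[OF that]] by simp
  have nadj: "d (?s p) (?s q) \<noteq> 1" if "q - p \<notin> shrikhande_gens" for p q
    using adj_shift[OF z] that adj_def by blast
  have d: "d (?s p) (?s q) = d ?z (?s (q - p))" if "q - p \<in> shrikhande_gens" for p q
    using rel_shift_diff(1)[OF z that, of q p] by (simp add: rel_def)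
  consider "rel ?z (?s (1, 0)) = (1, 2)" | "rel ?z (?s (1, 0)) = (2, 1)"
    using shift_label[OF z C(1)] by blast
  then show ?thesis
  proof cases
    case 1
    have "d (?s p) (?s q) = 1 \<longleftrightarrow> q - p \<in> ?C" for p q
    proof (cases "q - p \<in> shrikhande_gens")
      case True
      show ?thesis
      proof (cases "q - p \<in> ?C")
        case True
        then show ?thesis
          using same[OF True] 1 d[OF Cg[OF True]] by (simp add: rel_def)
      next
        case False
        then have "rel ?z (?s (q - p)) = rel (?s (1, 0)) ?z"
          using neg[of "- (q - p)"] gens[OF True] by (simp only: minus_minus) simp
        then show ?thesis
          using False 1 d[OF True] by (simp add: rel_def)
      qed
    next
      case False
      then show ?thesis
        using nadj Cg by blast
    qed
    then show ?thesis
      using that shift_parametrization by blast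
  next
    case 2
    have "d (?s (- p)) (?s (- q)) = 1 \<longleftrightarrow> q - p \<in> ?C" for p q
    proof -
      have m: "- q - - p = - (q - p)"
        by simp
      show ?thesis
      proof (cases "q - p \<in> shrikhande_gens")
        case True
        then have g: "- q - - p \<in> shrikhande_gens"
          unfolding m by (simp only: uminus_gens_iff)
        show ?thesis
        proof (cases "q - p \<in> ?C")
          case True
          then show ?thesis
            using neg[OF True] 2 d[OF g] unfolding m by (simp add: rel_def)
        next
          case False
          then have n: "- (q - p) \<in> ?C"
            using gens[OF True] by blast
          show ?thesis
            using same[OF n] False 2 d[OF g] unfolding m by (simp add: rel_def)
        qed
      next
        case False
        then have "- q - - p \<notin> shrikhande_gens"
          unfolding m by (simp only: uminus_gens_iff not_False_eq_True)
        then show ?thesis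
          using nadj False Cg by blast
      qed
    qed
    moreover have "bij_betw (?s \<circ> uminus) UNIV V"
      using bij_betw_trans[OF _ shift_parametrization, of uminus UNIV] by (simp add: bij_uminus)
    ultimately show ?thesis
      using that[of "?s \<circ> uminus"] by simp
  qed
qed

end

section \<open>From digraphs to functions\<close>

text \<open>Tail and head of a pair digraph are the projections, so the arc map of an isomorphism is
  determined by its vertex map.\<close>

lemma digraph_iso_pairD:
  fixes G :: "'a pair_pre_digraph" and H :: "'b pair_pre_digraph"
  assumes "digraph_iso G H"
  obtains f where "bij_betw f (pverts G) (pverts H)" "parcs H = map_prod f f ` parcs G"
proof -
  obtain h where h: "pre_digraph.digraph_isomorphism G h" "with_proj H = app_iso h G"
    using assms by (auto simp: digraph_iso_def)
  have H: "pverts H = iso_verts h ` pverts G" "parcs H = iso_arcs h ` parcs G" "iso_tail h = fst" "iso_head h = snd"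
    using arg_cong[OF h(2), of verts] arg_cong[OF h(2), of arcs] arg_cong[OF h(2), of tail] arg_cong[OF h(2), of head]
    by simp_all
  have "inj_on (iso_verts h) (pverts G)"
    and a: "\<And>e. e \<in> parcs G \<Longrightarrow> iso_verts h (fst e) = fst (iso_arcs h e) \<and> iso_verts h (snd e) = snd (iso_arcs h e)"
    using h(1) H(3,4) by (auto simp: pre_digraph.digraph_isomorphism_def)
  moreover have "iso_arcs h e = map_prod (iso_verts h) (iso_verts h) e" if "e \<in> parcs G" for e
    using a[OF that] by (simp add: prod_eq_iff)
  then have "parcs H = map_prod (iso_verts h) (iso_verts h) ` parcs G"
    using H(2) by (auto intro!: image_cong)
  ultimately show ?thesis
    using that H(1) by (simp add: bij_betw_def)
qed

lemma digraph_iso_pairI: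
  fixes G :: "'a pair_pre_digraph" and H :: "'b pair_pre_digraph"
  assumes "pair_wf_digraph G" "bij_betw f (pverts G) (pverts H)"
    and arcs: "parcs H = map_prod f f ` parcs G"
  shows "digraph_iso G H"
proof -
  interpret pair_wf_digraph G
    by fact
  let ?h = "\<lparr>iso_verts = f, iso_arcs = map_prod f f, iso_head = snd, iso_tail = fst\<rparr>"
  have inj: "inj_on f (pverts G)"
    using assms(2) by (simp add: bij_betw_def)
  then have "inj_on (map_prod f f) (pverts G \<times> pverts G)"
    by (simp add: map_prod_inj_on)
  then have "inj_on (map_prod f f) (parcs G)"
    by (rule inj_on_subset) (use in_arcsD1 in_arcsD2 in auto)
  then have "digraph_isomorphism ?h"
    unfolding digraph_isomorphism_def using inj wf_digraph by auto
  moreover have "with_proj H = app_iso ?h G"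
    using assms(2) arcs by (simp add: app_iso_def with_proj_def bij_betw_def)
  ultimately show ?thesis
    unfolding digraph_iso_def by blast
qed

lemma in_parcs_image_iff:
  assumes "inj_on f V" "A \<subseteq> V \<times> V" "x \<in> V" "y \<in> V"
  shows "(f x, f y) \<in> map_prod f f ` A \<longleftrightarrow> (x, y) \<in> A"
  using assms by (auto dest: inj_onD)

lemma in_mk_symmetric_iff:
  "(x, y) \<in> parcs (mk_symmetric (with_proj G)) \<longleftrightarrow> (x, y) \<in> parcs G \<or> (y, x) \<in> parcs G"
proof -
  have "(x, y) \<in> parcs (mk_symmetric (with_proj G)) \<longleftrightarrow> (\<exists>e\<in>parcs G. e = (x, y) \<or> e = (y, x))"
    unfolding parcs_mk_symmetric by (simp add: prod_eq_iff) metis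
  then show ?thesis
    by blast
qed

section \<open>Directed distance in a strongly connected digraph\<close>

context pair_digraph
begin

lemma directed_distance_le: "awalk x p y \<Longrightarrow> directed_distance G x y \<le> length p"
  unfolding directed_distance_def by (rule Least_le) blast

lemma directed_distance_attained:
  assumes "strongly_connected G" "x \<in> pverts G" "y \<in> pverts G"
  obtains p where "awalk x p y" "length p = directed_distance G x y"
proof -
  have "x \<rightarrow>\<^sup>*\<^bsub>with_proj G\<^esub> y"
    using assms by (auto simp: strongly_connected_def)
  then have "\<exists>n p. awalk x p y \<and> length p = n"
    by (simp add: reachable_awalk)
  then have "\<exists>p. awalk x p y \<and> length p = directed_distance G x y"
    unfolding directed_distance_def by (rule LeastI_ex)
  then show ?thesis
    using that by blast
qed

lemma directed_distance_eq_0_iff: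
  assumes "strongly_connected G" "x \<in> pverts G" "y \<in> pverts G"
  shows "directed_distance G x y = 0 \<longleftrightarrow> x = y"
proof
  assume "directed_distance G x y = 0"
  then show "x = y"
    using directed_distance_attained[OF assms] by (metis awalk_Nil_iff length_0_conv)
next
  assume "x = y"
  then show "directed_distance G x y = 0"
    using directed_distance_le[of x "[]" y] assms by (simp add: awalk_Nil_iff)
qed

lemma directed_distance_eq_1_iff:
  assumes "strongly_connected G" "x \<in> pverts G" "y \<in> pverts G"
  shows "directed_distance G x y = 1 \<longleftrightarrow> (x, y) \<in> parcs G"
proof
  assume "directed_distance G x y = 1"
  then obtain e where "awalk x [e] y"
    using directed_distance_attained[OF assms] by (metis One_nat_def length_0_conv length_Suc_conv)
  then show "(x, y) \<in> parcs G"
    by (cases e) (auto simp: awalk_Cons_iff awalk_Nil_iff)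
next
  assume a: "(x, y) \<in> parcs G"
  then have "awalk x [(x, y)] y"
    using assms by (simp add: awalk_Cons_iff awalk_Nil_iff)
  then have "directed_distance G x y \<le> 1"
    using directed_distance_le[of x "[(x, y)]" y] by simp
  moreover have "x \<noteq> y"
    using a no_loops[of "(x, y)"] by simp
  ultimately show "directed_distance G x y = 1"
    using directed_distance_eq_0_iff[OF assms] by linarith
qed

lemma directed_distance_triangle:
  assumes "strongly_connected G" "x \<in> pverts G" "y \<in> pverts G" "z \<in> pverts G"
  shows "directed_distance G x z \<le> directed_distance G x y + directed_distance G y z"
proof -
  obtain p q where "awalk x p y" "length p = directed_distance G x y"
    "awalk y q z" "length q = directed_distance G y z"
    using directed_distance_attained assms by metis
  then show ?thesis
    using directed_distance_le[OF awalk_appendI] by (metis length_append)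
qed

lemma directed_distance_midpoint:
  assumes sc: "strongly_connected G" and V: "x \<in> pverts G" "z \<in> pverts G"
    and 2: "directed_distance G x z = 2"
  shows "\<exists>y\<in>pverts G. directed_distance G x y = 1 \<and> directed_distance G y z = 1"
proof -
  obtain p where "awalk x p z" "length p = 2"
    using directed_distance_attained[OF sc V] 2 by metis
  then obtain e e' where "awalk x [e, e'] z"
    by (auto simp: numeral_2_eq_2 length_Suc_conv)
  then have "(x, snd e) \<in> parcs G" "(snd e, z) \<in> parcs G"
    by (cases e; cases e'; auto simp: awalk_Cons_iff awalk_Nil_iff)+
  moreover from this have "snd e \<in> pverts G"
    using in_arcsD2 by blast
  ultimately show ?thesis
    using directed_distance_eq_1_iff sc V by blast
qed

end

section \<open>Intersection numbers as existence of midpoints\<close>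

context weakly_distance_regular_digraph
begin

text \<open>The vertex \<open>z\<close> makes the cardinality for the first pair positive; the equal
  cardinality for the second pair then supplies a midpoint there.\<close>

lemma transfer_vertex:
  assumes V: "x \<in> pverts G" "y \<in> pverts G" "x' \<in> pverts G" "y' \<in> pverts G" "z \<in> pverts G"
    and eq: "two_way_distance G x y = two_way_distance G x' y'"
  shows "\<exists>z'\<in>pverts G. two_way_distance G x' z' = two_way_distance G x z \<and>
    two_way_distance G z' y' = two_way_distance G z y"
proof -
  let ?P = "P_set G (two_way_distance G x z) (two_way_distance G z y)"
  have fin: "finite (?P u v)" for u v
    by (rule finite_subset[OF _ finite_verts]) (auto simp: P_set_def)
  have "two_way_distance G x z \<in> two_way_distances G" "two_way_distance G z y \<in> two_way_distances G"
    using V by (auto simp: two_way_distances_def)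
  then have "card (?P x y) = card (?P x' y')"
    using weakly_distance_regular V eq by blast
  moreover have "z \<in> ?P x y"
    using V by (simp add: P_set_def)
  ultimately have "?P x' y' \<noteq> {}"
    using fin by (metis card_gt_0_iff card.empty empty_iff)
  then show ?thesis
    by (auto simp: P_set_def)
qed

lemma intersection_number_eq:
  assumes V: "x \<in> pverts G" "y \<in> pverts G" and ij: "i \<in> two_way_distances G" "j \<in> two_way_distances G"
  shows "intersection_number G (two_way_distance G x y) i j = card (P_set G i j x y)"
  unfolding intersection_number_def
  by (rule the_equality) (use V weakly_distance_regular[OF ij] in blast)+

end

context commutative_weakly_distance_regular_digraph
begin

lemma commute_vertex:
  assumes V: "x \<in> pverts G" "y \<in> pverts G" "z \<in> pverts G"
  shows "\<exists>z'\<in>pverts G. two_way_distance G x z' = two_way_distance G z y \<and>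
    two_way_distance G z' y = two_way_distance G x z"
proof -
  let ?i = "two_way_distance G x z" and ?j = "two_way_distance G z y"
  have ij: "?i \<in> two_way_distances G" "?j \<in> two_way_distances G" "two_way_distance G x y \<in> two_way_distances G"
    using V by (auto simp: two_way_distances_def)
  then have "card (P_set G ?i ?j x y) = card (P_set G ?j ?i x y)"
    using commutative[OF ij(3,1,2)] intersection_number_eq V by simp
  moreover have "z \<in> P_set G ?i ?j x y" "finite (P_set G ?i ?j x y)"
    using V by (auto simp: P_set_def intro: finite_subset[OF _ finite_verts])
  ultimately have "P_set G ?j ?i x y \<noteq> {}"
    by (metis card_gt_0_iff card.empty empty_iff)
  then show ?thesis
    by (auto simp: P_set_def)
qed

end

section \<open>Doob graphs on lists and on functions\<close>

lemma in_parcs_Cay_iff: "(u, v) \<in> parcs (Cay C) \<longleftrightarrow> v - u \<in> C"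
proof
  assume "v - u \<in> C"
  then have "\<exists>g c. (u, v) = (g, g + c) \<and> c \<in> C"
    by (intro exI[of _ u] exI[of _ "v - u"]) simp
  then show "(u, v) \<in> parcs (Cay C)"
    by (simp add: Cay_def)
qed (auto simp: Cay_def)

lemma shrikhande_graph_simps:
  "pverts shrikhande_graph = UNIV" "(u, v) \<in> parcs shrikhande_graph \<longleftrightarrow> v - u \<in> shrikhande_gens"
proof -
  show "pverts shrikhande_graph = UNIV"
    by (simp add: shrikhande_graph_def Cay_def)
  show "(u, v) \<in> parcs shrikhande_graph \<longleftrightarrow> v - u \<in> shrikhande_gens"
    by (simp only: shrikhande_graph_def in_parcs_Cay_iff shrikhande_gens_def)
qed

lemma pverts_cartesian_power_shrikhande:
  "pverts (cartesian_power shrikhande_graph n) = {us. length us = n}"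
  by (induction n) (auto simp: cartesian_product_def shrikhande_graph_simps length_Suc_conv)

lemma in_parcs_cartesian_product_iff:
  "((u, v), (u', v')) \<in> parcs (cartesian_product G H) \<longleftrightarrow>
    u \<in> pverts G \<and> u' \<in> pverts G \<and> v \<in> pverts H \<and> v' \<in> pverts H \<and>
    (u = u' \<and> (v, v') \<in> parcs H \<or> (u, u') \<in> parcs G \<and> v = v')"
  by (auto simp: cartesian_product_def)

lemma in_parcs_cartesian_power_Suc_iff:
  "(u # us, v # vs) \<in> parcs (cartesian_power G (Suc n)) \<longleftrightarrow>
    ((u, us), (v, vs)) \<in> parcs (cartesian_product G (cartesian_power G n))"
  by auto

lemma in_parcs_cartesian_power_shrikhande_iff:
  "(us, vs) \<in> parcs (cartesian_power shrikhande_graph n) \<longleftrightarrow> length us = n \<and> length vs = n \<and>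
    (\<exists>i<n. vs ! i - us ! i \<in> shrikhande_gens \<and> (\<forall>j<n. j \<noteq> i \<longrightarrow> us ! j = vs ! j))"
proof (induction n arbitrary: us vs)
  case (Suc n)
  \<comment> \<open>Separates index 0, the copy added at the head of the list, from the indices of
    the smaller power.\<close>
  have *: "(\<exists>i<Suc n. P i \<and> (\<forall>j<Suc n. j \<noteq> i \<longrightarrow> Q j)) \<longleftrightarrow>
      P 0 \<and> (\<forall>j<n. Q (Suc j)) \<or> Q 0 \<and> (\<exists>i<n. P (Suc i) \<and> (\<forall>j<n. j \<noteq> i \<longrightarrow> Q (Suc j)))" for P Q
    by (auto simp: Ex_less_Suc2 All_less_Suc2)
  show ?case
  proof (cases us)
    case Nil
    then show ?thesis
      by simp
  next
    case us: (Cons u us')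
    show ?thesis
    proof (cases vs)
      case Nil
      then show ?thesis
        by simp
    next
      case vs: (Cons v vs')
      have "(us, vs) \<in> parcs (cartesian_power shrikhande_graph (Suc n)) \<longleftrightarrow>
          length us' = n \<and> length vs' = n \<and>
          (u = v \<and> (us', vs') \<in> parcs (cartesian_power shrikhande_graph n) \<or> v - u \<in> shrikhande_gens \<and> us' = vs')"
        unfolding us vs in_parcs_cartesian_power_Suc_iff in_parcs_cartesian_product_iff
        by (auto simp: shrikhande_graph_simps pverts_cartesian_power_shrikhande)
      also have "\<dots> \<longleftrightarrow> length us = Suc n \<and> length vs = Suc n \<and>
        (\<exists>i<Suc n. vs ! i - us ! i \<in> shrikhande_gens \<and> (\<forall>j<Suc n. j \<noteq> i \<longrightarrow> us ! j = vs ! j))"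
        unfolding * Suc.IH by (auto simp: us vs list_eq_iff_nth_eq)
      finally show ?thesis .
    qed
  qed
qed simp

text \<open>The order changes: clique coordinates follow the Shrikhande ones in a function, whereas
  the Hamming factor comes first in \<open>doob_graph\<close>.\<close>

definition doob_decode :: "nat \<Rightarrow> nat \<Rightarrow> (nat \<Rightarrow> 4 \<times> 4) \<Rightarrow> 4 list \<times> (4 \<times> 4) list" where
  "doob_decode d1 d2 x = (map (\<lambda>i. fst (x (d1 + i))) [0..<d2], map x [0..<d1])"

lemma doob_verts_eqI:
  assumes "x \<in> doob_verts d1 d2" "y \<in> doob_verts d1 d2"
    and "\<And>i. i < d1 \<Longrightarrow> x i = y i" "\<And>i. i < d2 \<Longrightarrow> fst (x (d1 + i)) = fst (y (d1 + i))"
  shows "x = y"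
proof
  fix i
  have V: "x i \<in> fibre d1 d2 i" "y i \<in> fibre d1 d2 i"
    using assms(1,2) by (auto simp: doob_verts_def)
  consider "i < d1" | "d1 \<le> i" "i < d1 + d2" | "d1 + d2 \<le> i"
    by linarith
  then show "x i = y i"
  proof cases
    case 2
    then have "fst (x i) = fst (y i)"
      using assms(4)[of "i - d1"] by simp
    then show ?thesis
      using V 2 by (auto simp: fibre_def)
  next
    case 3
    then show ?thesis
      using V by (simp add: fibre_def)
  qed (use assms(3) in blast)
qed

lemma pverts_doob_graph: "pverts (doob_graph d1 d2) = {(xs, us). length xs = d2 \<and> length us = d1}"
  by (auto simp: doob_graph_def cartesian_product_def hamming_graph_def pverts_cartesian_power_shrikhande)

lemma bij_betw_doob_decode: "bij_betw (doob_decode d1 d2) (doob_verts d1 d2) (pverts (doob_graph d1 d2))"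
proof (rule bij_betw_imageI)
  show "inj_on (doob_decode d1 d2) (doob_verts d1 d2)"
    by (rule inj_onI, rule doob_verts_eqI) (auto simp: doob_decode_def)
  have "p \<in> doob_decode d1 d2 ` doob_verts d1 d2" if p: "p \<in> pverts (doob_graph d1 d2)" for p
  proof -
    obtain xs us where xu: "p = (xs, us)" "length xs = d2" "length us = d1"
      using p by (auto simp: pverts_doob_graph)
    define x where "x = (\<lambda>i. if i < d1 then us ! i else if i < d1 + d2 then (xs ! (i - d1), 0) else 0)"
    have "x \<in> doob_verts d1 d2"
      by (simp add: doob_verts_def fibre_def x_def)
    moreover have "p = doob_decode d1 d2 x"
      using xu by (auto simp: doob_decode_def x_def intro!: nth_equalityI)
    ultimately show ?thesis
      by blast
  qed
  moreover have "doob_decode d1 d2 x \<in> pverts (doob_graph d1 d2)" for x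
    by (simp add: doob_decode_def pverts_doob_graph)
  ultimately show "doob_decode d1 d2 ` doob_verts d1 d2 = pverts (doob_graph d1 d2)"
    by blast
qed

text \<open>The fibre constraints make first components decide equality in clique coordinates and
  leave no difference from \<open>d1 + d2\<close> on, so the single changed coordinate shows up in
  exactly one of the two lists.\<close>

lemma in_parcs_doob_graph_iff:
  assumes V: "x \<in> doob_verts d1 d2" "y \<in> doob_verts d1 d2"
  shows "(doob_decode d1 d2 x, doob_decode d1 d2 y) \<in> parcs (doob_graph d1 d2) \<longleftrightarrow> doob_adj d1 x y"
proof -
  have eq: "fst (x (d1 + i)) = fst (y (d1 + i)) \<longleftrightarrow> x (d1 + i) = y (d1 + i)"
    if "i < d2" for i
  proof -
    have "x (d1 + i) \<in> fibre d1 d2 (d1 + i)" "y (d1 + i) \<in> fibre d1 d2 (d1 + i)"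
      using V by (auto simp: doob_verts_def)
    then show ?thesis
      using that by (auto simp: fibre_def)
  qed
  have out: "x i = y i" if "d1 + d2 \<le> i" for i
  proof -
    have "x i \<in> fibre d1 d2 i" "y i \<in> fibre d1 d2 i"
      using V by (auto simp: doob_verts_def)
    then show ?thesis
      using that by (simp add: fibre_def)
  qed
  let ?S = "\<exists>i<d1. y i - x i \<in> shrikhande_gens \<and> (\<forall>j<d1. j \<noteq> i \<longrightarrow> x j = y j)"
  let ?H = "\<exists>i<d2. x (d1 + i) \<noteq> y (d1 + i) \<and> (\<forall>j<d2. j \<noteq> i \<longrightarrow> x (d1 + j) = y (d1 + j))"
  have "card {i. i < d2 \<and> fst (x (d1 + i)) \<noteq> fst (y (d1 + i))} = 1 \<longleftrightarrow> ?H"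
    unfolding card_1_singleton_iff One_nat_def using eq by (simp add: set_eq_iff) metis
  moreover have "{i. i < d2 \<and> map (\<lambda>i. fst (x (d1 + i))) [0..<d2] ! i \<noteq> map (\<lambda>i. fst (y (d1 + i))) [0..<d2] ! i} =
      {i. i < d2 \<and> fst (x (d1 + i)) \<noteq> fst (y (d1 + i))}"
    by auto
  moreover have "map (\<lambda>i. fst (x (d1 + i))) [0..<d2] = map (\<lambda>i. fst (y (d1 + i))) [0..<d2] \<longleftrightarrow>
      (\<forall>i<d2. x (d1 + i) = y (d1 + i))"
    using eq by auto
  moreover have "(map x [0..<d1], map y [0..<d1]) \<in> parcs (cartesian_power shrikhande_graph d1) \<longleftrightarrow> ?S"
    unfolding in_parcs_cartesian_power_shrikhande_iff by auto
  ultimately have "(doob_decode d1 d2 x, doob_decode d1 d2 y) \<in> parcs (doob_graph d1 d2) \<longleftrightarrow>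
      (\<forall>i<d2. x (d1 + i) = y (d1 + i)) \<and> ?S \<or> ?H \<and> (\<forall>i<d1. x i = y i)"
    by (simp add: doob_decode_def doob_graph_def cartesian_product_def hamming_graph_def
        pverts_cartesian_power_shrikhande Ball_def)
  also have "\<dots> \<longleftrightarrow> doob_adj d1 x y"
  proof
    assume "(\<forall>i<d2. x (d1 + i) = y (d1 + i)) \<and> ?S \<or> ?H \<and> (\<forall>i<d1. x i = y i)"
    then show "doob_adj d1 x y"
    proof
      assume a: "(\<forall>i<d2. x (d1 + i) = y (d1 + i)) \<and> ?S"
      then obtain i where i: "i < d1" "y i - x i \<in> shrikhande_gens" "\<And>j. j < d1 \<Longrightarrow> j \<noteq> i \<Longrightarrow> x j = y j"
        by blast
      have "x j = y j" if "j \<noteq> i" for j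
        using that i(3) a out[of j] by (metis add_diff_inverse_nat nat_add_left_cancel_less not_less)
      moreover have "fibre_adj d1 i (x i) (y i)"
        using i zero_notin_gens by (auto simp: fibre_adj_def)
      ultimately show ?thesis
        unfolding doob_adj_def by blast
    next
      assume a: "?H \<and> (\<forall>i<d1. x i = y i)"
      then obtain i where i: "x (d1 + i) \<noteq> y (d1 + i)" "\<And>j. j < d2 \<Longrightarrow> j \<noteq> i \<Longrightarrow> x (d1 + j) = y (d1 + j)"
        by blast
      have "x j = y j" if "j \<noteq> d1 + i" for j
        using that i(2) a out[of j] by (metis add_diff_inverse_nat nat_add_left_cancel_less not_less)
      moreover have "fibre_adj d1 (d1 + i) (x (d1 + i)) (y (d1 + i))"
        using i by (simp add: fibre_adj_def)
      ultimately show ?thesis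
        unfolding doob_adj_def by blast
    qed
  next
    assume "doob_adj d1 x y"
    then obtain i where i: "fibre_adj d1 i (x i) (y i)" "\<And>j. j \<noteq> i \<Longrightarrow> x j = y j"
      unfolding doob_adj_def by blast
    then have ne: "x i \<noteq> y i"
      by (simp add: fibre_adj_def)
    then have "i < d1 + d2"
      using out not_less by blast
    then consider "i < d1" | j where "i = d1 + j" "j < d2"
      by (metis add_diff_inverse_nat nat_add_left_cancel_less)
    then show "(\<forall>i<d2. x (d1 + i) = y (d1 + i)) \<and> ?S \<or> ?H \<and> (\<forall>i<d1. x i = y i)"
    proof cases
      case 1
      then have "y i - x i \<in> shrikhande_gens"
        using i(1) by (simp add: fibre_adj_def)
      moreover have "\<forall>j<d2. x (d1 + j) = y (d1 + j)"
        using 1 i(2) by simp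
      ultimately show ?thesis
        using 1 i(2) by blast
    next
      case 2
      then have "?H \<and> (\<forall>i<d1. x i = y i)"
        using ne i(2) by (metis add_left_cancel not_add_less1)
      then show ?thesis
        by blast
    qed
  qed
  finally show ?thesis .
qed

text \<open>Distances are pulled back along \<open>g\<close>, so that translations of coordinates
  become available while regularity is still that of the digraph.\<close>

lemma (in commutative_weakly_distance_regular_digraph) doob_schemeI:
  assumes g: "bij_betw g (doob_verts d1 d2) (pverts G)"
    and arcs: "\<And>x y. \<lbrakk>x \<in> doob_verts d1 d2; y \<in> doob_verts d1 d2\<rbrakk> \<Longrightarrow>
      (g x, g y) \<in> parcs G \<or> (g y, g x) \<in> parcs G \<longleftrightarrow> doob_adj d1 x y"
  shows "doob_scheme d1 d2 (\<lambda>x y. directed_distance G (g x) (g y))"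
proof -
  let ?V = "doob_verts d1 d2" and ?d = "\<lambda>x y. directed_distance G (g x) (g y)"
  note sc = strongly_connected
  have gV: "g x \<in> pverts G" if "x \<in> ?V" for x
    using that g bij_betwE by blast
  have surj: "\<exists>x\<in>?V. g x = v" if "v \<in> pverts G" for v
    using that g by (metis bij_betw_imp_surj_on imageE)
  have adj: "(?d x y = 1 \<or> ?d y x = 1) \<longleftrightarrow> doob_adj d1 x y"
    if "x \<in> ?V" "y \<in> ?V" for x y
    using directed_distance_eq_1_iff[OF sc] gV arcs that by simp
  show ?thesis
  proof (unfold_locales, goal_cases)
    case (1 x y)
    then show ?case
      using directed_distance_eq_0_iff[OF sc] gV g by (metis bij_betw_inv_into_left)
  next
    case (2 x y z)
    then show ?case
      using directed_distance_triangle[OF sc] gV by blast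
  next
    case (3 x z)
    then show ?case
      using directed_distance_midpoint[OF sc gV gV] surj by metis
  next
    case (4 x y x' y' z)
    then have "two_way_distance G (g x) (g y) = two_way_distance G (g x') (g y')"
      by (simp add: two_way_distance_def)
    then show ?case
      using transfer_vertex[OF gV gV gV gV gV, of x y x' y' z] 4 surj unfolding two_way_distance_def by metis
  next
    case (5 x y z)
    then show ?case
      using commute_vertex[OF gV gV gV, of x y z] surj unfolding two_way_distance_def by metis
  next
    case (6 x z y1 y2 y3)
    have "doob_adj d1 x y \<and> doob_adj d1 y z" if "y \<in> {y1, y2, y3}" for y
      using 6(7)[OF that] adj that 6(1,2,4-6) by blast
    then show ?case
      using doob_common_neighbours[OF 6(1-6)] by blast
  next
    case (7 x y)
    then show ?case
      using adj by blast
  qed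
qed

theorem theorem1p3:
  fixes \<Gamma> :: "'a pair_pre_digraph"
  assumes "commutative_weakly_distance_regular_digraph \<Gamma>"
    and "\<not> symmetric \<Gamma>"
  shows "(\<exists>d1 d2. d1 > 0 \<and> digraph_iso (mk_symmetric \<Gamma>) (doob_graph d1 d2)) \<longleftrightarrow>
    digraph_iso \<Gamma> (Cay {(1, 0), (0, 1), (-1, -1)} :: (4 \<times> 4) pair_pre_digraph)"
    (is "?L \<longleftrightarrow> ?R")
proof
  interpret commutative_weakly_distance_regular_digraph \<Gamma>
    by fact
  have wf: "pair_wf_digraph \<Gamma>" "pair_wf_digraph (mk_symmetric \<Gamma>)"
    by unfold_locales[1] (rule wellformed_mk_symmetric)
  have arcs: "parcs \<Gamma> \<subseteq> pverts \<Gamma> \<times> pverts \<Gamma>"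
    using in_arcsD1 in_arcsD2 by auto
  then have arcs': "parcs (mk_symmetric \<Gamma>) \<subseteq> pverts \<Gamma> \<times> pverts \<Gamma>"
    by (auto simp: in_mk_symmetric_iff)
  {
    assume ?L
    then obtain d1 d2 where d1: "0 < d1" and iso: "digraph_iso (mk_symmetric \<Gamma>) (doob_graph d1 d2)"
      by blast
    obtain f where f: "bij_betw f (pverts \<Gamma>) (pverts (doob_graph d1 d2))"
        "parcs (doob_graph d1 d2) = map_prod f f ` parcs (mk_symmetric \<Gamma>)"
      using digraph_iso_pairD[OF iso] by auto
    define g where "g = inv_into (pverts \<Gamma>) f \<circ> doob_decode d1 d2"
    have g: "bij_betw g (doob_verts d1 d2) (pverts \<Gamma>)"
      unfolding g_def using bij_betw_doob_decode bij_betw_inv_into[OF f(1)] by (rule bij_betw_trans)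
    have fg: "f (g x) = doob_decode d1 d2 x" if "x \<in> doob_verts d1 d2" for x
      using that bij_betw_inv_into_right[OF f(1)] bij_betwE[OF bij_betw_doob_decode] by (simp add: g_def)
    have gV: "g x \<in> pverts \<Gamma>" if "x \<in> doob_verts d1 d2" for x
      using that bij_betwE[OF g] by blast
    have "(g x, g y) \<in> parcs \<Gamma> \<or> (g y, g x) \<in> parcs \<Gamma> \<longleftrightarrow> doob_adj d1 x y"
      if "x \<in> doob_verts d1 d2" "y \<in> doob_verts d1 d2" for x y
      using in_parcs_doob_graph_iff[OF that] in_parcs_image_iff[OF _ arcs' gV gV, of f x y] that f
      by (simp add: fg bij_betw_def in_mk_symmetric_iff)
    then interpret doob_scheme d1 d2 "\<lambda>x y. directed_distance \<Gamma> (g x) (g y)"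
      using doob_schemeI[OF g] by blast
    \<comment> \<open>An arc without its reverse is the directed edge that makes every Shrikhande
      step directed.\<close>
    obtain u v where uv: "(u, v) \<in> parcs \<Gamma>" "(v, u) \<notin> parcs \<Gamma>"
      using assms(2) by (auto simp: symmetric_def sym_def)
    have "u \<in> g ` V" "v \<in> g ` V"
      using uv(1) arcs bij_betw_imp_surj_on[OF g] by auto
    then obtain p q where pq: "p \<in> V" "q \<in> V" "u = g p" "v = g q"
      by blast
    have one: "directed_distance \<Gamma> (g x) (g y) = 1 \<longleftrightarrow> (g x, g y) \<in> parcs \<Gamma>"
      if "x \<in> V" "y \<in> V" for x y
      using directed_distance_eq_1_iff[OF strongly_connected gV gV] that by blast
    have "adj p q" "rel p q \<noteq> rel q p"
      using one[of p q] one[of q p] uv pq by (auto simp: adj_def rel_def)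
    then interpret directed_doob_scheme d1 d2 "\<lambda>x y. directed_distance \<Gamma> (g x) (g y)"
      using d1 shifts_directed[OF d1 pq(1,2)] by unfold_locales blast+
    obtain h :: "4 \<times> 4 \<Rightarrow> nat \<Rightarrow> 4 \<times> 4" where h: "bij_betw h UNIV V"
        "\<And>p q. directed_distance \<Gamma> (g (h p)) (g (h q)) = 1 \<longleftrightarrow> q - p \<in> {(1, 0), (0, 1), (-1, -1)}"
      using cayley_parametrization by blast
    have hV: "h p \<in> V" for p
      using bij_betwE[OF h(1)] by blast
    define e where "e = inv_into UNIV (g \<circ> h)"
    have gh: "bij_betw (g \<circ> h) UNIV (pverts \<Gamma>)"
      using bij_betw_trans[OF h(1) g] .
    then have e: "bij_betw e (pverts \<Gamma>) UNIV"
      unfolding e_def by (rule bij_betw_inv_into)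
    have "(p, q) \<in> parcs (Cay {(1, 0), (0, 1), (-1, -1)}) \<longleftrightarrow> (g (h p), g (h q)) \<in> parcs \<Gamma>" for p q
      unfolding in_parcs_Cay_iff using h(2) one hV by blast
    moreover have "(p, q) \<in> map_prod e e ` parcs \<Gamma> \<longleftrightarrow> (g (h p), g (h q)) \<in> parcs \<Gamma>" for p q
    proof -
      have "e (g (h p)) = p" for p
        unfolding e_def using bij_betw_inv_into_left[OF gh, of p] by simp
      then show ?thesis
        using in_parcs_image_iff[OF bij_betw_imp_inj_on[OF e] arcs gV[OF hV] gV[OF hV], of p q] by simp
    qed
    ultimately have "parcs (Cay {(1, 0), (0, 1), (-1, -1)}) = map_prod e e ` parcs \<Gamma>"
      by (intro equalityI subrelI) blast+
    moreover have "pverts (Cay {(1, 0), (0, 1), (-1, -1)} :: (4 \<times> 4) pair_pre_digraph) = UNIV"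
      by (simp add: Cay_def)
    ultimately show ?R
      using digraph_iso_pairI[OF wf(1)] e by metis
  }
  {
    let ?K = "Cay {(1, 0), (0, 1), (-1, -1)} :: (4 \<times> 4) pair_pre_digraph"
    assume ?R
    then obtain f where f: "bij_betw f (pverts \<Gamma>) (pverts ?K)" "parcs ?K = map_prod f f ` parcs \<Gamma>"
      by (rule digraph_iso_pairD)
    \<comment> \<open>For \<open>d1 = 1\<close> and \<open>d2 = 0\<close> the Hamming factor has the
      single vertex \<open>[]\<close>, so the Doob graph is one Shrikhande graph in list
      form.\<close>
    let ?s = "\<lambda>p. ([], [p]) :: 4 list \<times> (4 \<times> 4) list"
    have "bij_betw ?s UNIV (pverts (doob_graph 1 0))"
      by (rule bij_betw_imageI) (auto simp: inj_on_def pverts_doob_graph length_Suc_conv)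
    moreover have "pverts ?K = UNIV"
      by (simp add: Cay_def)
    ultimately have sf: "bij_betw (?s \<circ> f) (pverts (mk_symmetric \<Gamma>)) (pverts (doob_graph 1 0))"
      using bij_betw_trans f(1) by simp
    \<comment> \<open>The Shrikhande generators are the connection set together with its negatives,
      and forgetting orientation adds precisely the negatives.\<close>
    have M: "(p, q) \<in> map_prod f f ` parcs (mk_symmetric \<Gamma>) \<longleftrightarrow> q - p \<in> shrikhande_gens" for p q
    proof -
      have "- c \<in> {(1, 0), (0, 1), (-1, -1)} \<longleftrightarrow> c \<in> {- (1, 0), - (0, 1), - (-1, -1)}" for c :: "4 \<times> 4"
        by (metis insert_iff empty_iff minus_minus)
      moreover have "{- (1, 0), - (0, 1), - (-1, -1)} = ({(-1, 0), (0, -1), (1, 1)} :: (4 \<times> 4) set)"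
        by simp
      ultimately have "- c \<in> {(1, 0), (0, 1), (-1, -1)} \<longleftrightarrow> c \<in> {(-1, 0), (0, -1), (1, 1)}" for c :: "4 \<times> 4"
        by metis
      from this[of "q - p"] have "q - p \<in> shrikhande_gens \<longleftrightarrow>
          q - p \<in> {(1, 0), (0, 1), (-1, -1)} \<or> - (q - p) \<in> {(1, 0), (0, 1), (-1, -1)}"
        unfolding shrikhande_gens_def by blast
      then have "q - p \<in> shrikhande_gens \<longleftrightarrow> (p, q) \<in> parcs ?K \<or> (q, p) \<in> parcs ?K"
        unfolding in_parcs_Cay_iff minus_diff_eq .
      moreover have "parcs (mk_symmetric \<Gamma>) = parcs \<Gamma> \<union> (parcs \<Gamma>)\<inverse>"
        by (auto simp: in_mk_symmetric_iff)
      then have "map_prod f f ` parcs (mk_symmetric \<Gamma>) = parcs ?K \<union> (parcs ?K)\<inverse>"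
        unfolding f(2) by force
      ultimately show ?thesis
        by simp
    qed
    have "e \<in> parcs (doob_graph 1 0) \<longleftrightarrow> (\<exists>p q. e = (?s p, ?s q) \<and> q - p \<in> shrikhande_gens)" for e
      by (cases e) (auto simp: doob_graph_def cartesian_product_def hamming_graph_def shrikhande_graph_simps)
    then have "parcs (doob_graph 1 0) =
        {(?s p, ?s q) | p q. (p, q) \<in> map_prod f f ` parcs (mk_symmetric \<Gamma>)}"
      unfolding M by blast
    also have "\<dots> = map_prod ?s ?s ` map_prod f f ` parcs (mk_symmetric \<Gamma>)"
    proof -
      have "{(?s p, ?s q) | p q. (p, q) \<in> M} = map_prod ?s ?s ` M" for M
        by force
      then show ?thesis .
    qed
    finally have "parcs (doob_graph 1 0) = map_prod ?s ?s ` map_prod f f ` parcs (mk_symmetric \<Gamma>)" .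
    then have "parcs (doob_graph 1 0) = map_prod (?s \<circ> f) (?s \<circ> f) ` parcs (mk_symmetric \<Gamma>)"
      by (simp add: image_comp map_prod.comp)
    then have "digraph_iso (mk_symmetric \<Gamma>) (doob_graph 1 0)"
      using digraph_iso_pairI[OF wf(2) sf] by blast
    then show ?L
      by (intro exI[of _ 1] exI[of _ 0]) simp
  }
qed

end
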